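(* Let $E$ be a separable normed space over $\mathbb{C}$. The set $X(T,E)\cup\{0\}$ contains a vector space which is dense in $H(T,E)$.
   Context: Here $\mathbb{N}=\{1,2,3,\dots\}$. $T$ is the set of vertices of a rooted tree with root $x_0$. $T_0=\{x_0\}$ and, for $n\in\mathbb{N}$, $T_n$ is the set of vertices at distance $n$ from $x_0$. For $x\in T$, $S(x)$ denotes the set of children of $x$. It is assumed that every $T_n$ is finite and every $S(x)$ has at least two elements (so $T$ is countably infinite). For each $x\in T$ and $y\in S(x)$ a real number $q(x,y)>0$ is given, with $\sum_{y\in S(x)}q(x,y)=1$ for every $x\in T$. Also fixed are weights $w(x,y)\in\mathbb{C}\setminus\{0\}$ for $x\in T$, $y\in S(x)$, with $\sum_{y\in S(x)}w(x,y)=1$ for every $x\in T$. Boundary: $\partial T$ is the set of infinite geodesics from $x_0$, i.e. sets $e=\{z_n:n\in\mathbb{N}\}$ with $z_1=x_0$ and $z_{n+1}\in S(z_n)$ for all $n$. For $x\in T$, $B_x=\{e\in\partial T: x\in e\}$. For $n\in\mathbb{N}$, $\mathcal{M}_n$ is the $\sigma$-algebra on $\partial T$ generated by the finite partition $\{B_x:x\in T_n\}$. For $x\in T_n$, with path $y_0=x_0,\dots,y_n=x$, $y_{j+1}\in S(y_j)$, put $p(B_x)=\prod_{j=0}^{n-1}q(y_j,y_{j+1})$; this determines a probability measure $\mathbb{P}_n$ on $\mathcal{M}_n$. By Kolmogorov's consistency theorem there is a probability measure $\mathbb{P}$ on $(\partial T,\mathcal{M})$, where $\mathcal{M}$ is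 the completion of the $\sigma$-algebra generated by $\bigcup_n\mathcal{M}_n$, with $\mathbb{P}|_{\mathcal{M}_n}=\mathbb{P}_n$ for all $n$. Let $d$ be the metric of $E$ induced by its norm. $L^0(\partial T,E)$ is the space of $\mathcal{M}$-measurable functions $\partial T\to E$ (preimages of open sets lie in $\mathcal{M}$), modulo almost everywhere equality, with the metric $P(\psi,\phi)=\int_{\partial T}\frac{d(\psi(e),\phi(e))}{1+d(\psi(e),\phi(e))}\,d\mathbb{P}(e)$ (topology of convergence in probability). $E^T$ carries the metric $\rho(f,g)=\sum_{n=1}^\infty 2^{-n}\frac{d(f(z_n),g(z_n))}{1+d(f(z_n),g(z_n))}$, where $\{z_n:n\in\mathbb{N}\}$ is an enumeration of $T$ (topology of pointwise convergence). A function $f:T\to E$ is (generalized) harmonic if $f(x)=\sum_{y\in S(x)}w(x,y)f(y)$ for all $x\in T$; $H(T,E)\subseteq E^T$ is the set of these functions, with the subspace topology. For $f\in H(T,E)$ and $n\in\mathbb{N}$, $\omega_n(f):\partial T\to E$ is given by $\omega_n(f)(e)=f(z)$, where $z$ is the unique element of $e\cap T_n$. $X(T,E)$ is the set of $f\in H(T,E)$ such that for every nonempty open set $V\subseteq L^0(\partial T,E)$ the set $\{n\in\mathbb{N}:\omega_n(f)\in V\}$ has upper density equal to one, where the upper density of $A\subseteq\mathbb{N}$ is $\limsup_{N\to\infty}|A\cap\{1,\dots,N\}|/N$. *)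

theory Defs
  imports "HOL-Probability.Probability" "HOL-Library.Function_Algebras"
begin

section \<open>Complex normed spaces\<close>

class complex_normed_vector = real_normed_vector +
  fixes scaleC :: "complex \<Rightarrow> 'a \<Rightarrow> 'a" (infixr "*\<^sub>C" 75)
  assumes scaleC_add_right: "a *\<^sub>C (x + y) = a *\<^sub>C x + a *\<^sub>C y"
    and scaleC_add_left: "(a + b) *\<^sub>C x = a *\<^sub>C x + b *\<^sub>C x"
    and scaleC_scaleC: "a *\<^sub>C (b *\<^sub>C x) = (a * b) *\<^sub>C x"
    and scaleC_one: "1 *\<^sub>C x = x"
    and scaleR_scaleC: "r *\<^sub>R x = complex_of_real r *\<^sub>C x"
    and norm_scaleC: "norm (a *\<^sub>C x) = cmod a * norm x"

definition scaleC_fun :: "complex \<Rightarrow> ('v \<Rightarrow> 'e::complex_normed_vector) \<Rightarrow> 'v \<Rightarrow> 'e" where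
  "scaleC_fun c f = (\<lambda>x. c *\<^sub>C f x)"

interpretation fun_space: vector_space "scaleC_fun :: complex \<Rightarrow> ('v \<Rightarrow> 'e::complex_normed_vector) \<Rightarrow> 'v \<Rightarrow> 'e"
  by unfold_locales
    (auto simp: scaleC_fun_def scaleC_add_right scaleC_add_left scaleC_scaleC scaleC_one)


section \<open>Rooted trees\<close>

text \<open>The vertex set \<open>T\<close> is the whole type \<^typ>\<open>'v\<close>; edges are given by an adjacency relation.\<close>

definition simple_path :: "('v \<Rightarrow> 'v \<Rightarrow> bool) \<Rightarrow> 'v \<Rightarrow> 'v list \<Rightarrow> 'v \<Rightarrow> bool" where
  "simple_path adj u xs v \<longleftrightarrow>
     xs \<noteq> [] \<and> hd xs = u \<and> last xs = v \<and> distinct xs \<and> successively adj xs"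

definition tree_graph :: "('v \<Rightarrow> 'v \<Rightarrow> bool) \<Rightarrow> bool" where
  "tree_graph adj \<longleftrightarrow> symp adj \<and> irreflp adj \<and> (\<forall>u v. \<exists>!xs. simple_path adj u xs v)"

definition graph_dist :: "('v \<Rightarrow> 'v \<Rightarrow> bool) \<Rightarrow> 'v \<Rightarrow> 'v \<Rightarrow> nat" where
  "graph_dist adj u v = (LEAST n. (adj ^^ n) u v)"

definition level :: "('v \<Rightarrow> 'v \<Rightarrow> bool) \<Rightarrow> 'v \<Rightarrow> nat \<Rightarrow> 'v set" where
  "level adj x0 n = {x. graph_dist adj x0 x = n}"

definition children :: "('v \<Rightarrow> 'v \<Rightarrow> bool) \<Rightarrow> 'v \<Rightarrow> 'v \<Rightarrow> 'v set" where
  "children adj x0 x = {y. adj x y \<and> graph_dist adj x0 y = Suc (graph_dist adj x0 x)}"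


section \<open>The boundary and its probability measure\<close>

text \<open>Rays are indexed from 0, so that \<open>y n\<close> is the vertex at level \<open>n\<close>.\<close>

definition is_ray :: "('v \<Rightarrow> 'v \<Rightarrow> bool) \<Rightarrow> 'v \<Rightarrow> (nat \<Rightarrow> 'v) \<Rightarrow> bool" where
  "is_ray adj x0 y \<longleftrightarrow> y 0 = x0 \<and> (\<forall>n. y (Suc n) \<in> children adj x0 (y n))"

definition boundary :: "('v \<Rightarrow> 'v \<Rightarrow> bool) \<Rightarrow> 'v \<Rightarrow> 'v set set" where
  "boundary adj x0 = {range y | y. is_ray adj x0 y}"

definition cyl :: "('v \<Rightarrow> 'v \<Rightarrow> bool) \<Rightarrow> 'v \<Rightarrow> 'v \<Rightarrow> 'v set set" where
  "cyl adj x0 x = {e \<in> boundary adj x0. x \<in> e}"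

definition level_algebra :: "('v \<Rightarrow> 'v \<Rightarrow> bool) \<Rightarrow> 'v \<Rightarrow> nat \<Rightarrow> 'v set set set" where
  "level_algebra adj x0 n = sigma_sets (boundary adj x0) (cyl adj x0 ` level adj x0 n)"

text \<open>
  \<open>\<mu>\<close> is the Kolmogorov measure on the uncompleted \<open>\<sigma>\<close>-algebra; it is determined uniquely by
  this predicate. The measure \<open>\<P>\<close> on \<open>\<M>\<close> is then \<^term>\<open>completion \<mu>\<close>.
\<close>

definition boundary_measure ::
    "('v \<Rightarrow> 'v \<Rightarrow> bool) \<Rightarrow> 'v \<Rightarrow> ('v \<Rightarrow> 'v \<Rightarrow> real) \<Rightarrow> 'v set measure \<Rightarrow> bool" where
  "boundary_measure adj x0 q \<mu> \<longleftrightarrow>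
     prob_space \<mu> \<and>
     space \<mu> = boundary adj x0 \<and>
     sets \<mu> = sigma_sets (boundary adj x0) (\<Union>n\<in>{1..}. level_algebra adj x0 n) \<and>
     (\<forall>n\<ge>1. \<forall>y. y 0 = x0 \<and> (\<forall>j<n. y (Suc j) \<in> children adj x0 (y j)) \<longrightarrow>
        measure \<mu> (cyl adj x0 (y n)) = (\<Prod>j<n. q (y j) (y (Suc j))))"


section \<open>The space of measurable functions modulo equality almost everywhere\<close>

definition bounded_dist :: "'e::metric_space \<Rightarrow> 'e \<Rightarrow> real" where
  "bounded_dist a b = dist a b / (1 + dist a b)"

definition ae_rel :: "'a measure \<Rightarrow> (('a \<Rightarrow> 'e::metric_space) \<times> ('a \<Rightarrow> 'e)) set" where
  "ae_rel M = {(\<psi>, \<phi>). \<psi> \<in> borel_measurable M \<and> \<phi> \<in> borel_measurable M \<and> (AE e in M. \<psi> e = \<phi> e)}"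

definition L0 :: "'a measure \<Rightarrow> ('a \<Rightarrow> 'e::metric_space) set set" where
  "L0 M = borel_measurable M // ae_rel M"

definition L0_dist :: "'a measure \<Rightarrow> ('a \<Rightarrow> 'e::metric_space) set \<Rightarrow> ('a \<Rightarrow> 'e) set \<Rightarrow> real" where
  "L0_dist M A B = (\<integral>e. bounded_dist ((SOME \<psi>. \<psi> \<in> A) e) ((SOME \<phi>. \<phi> \<in> B) e) \<partial>M)"

definition L0_topology :: "'a measure \<Rightarrow> ('a \<Rightarrow> 'e::metric_space) set topology" where
  "L0_topology M = Metric_space.mtopology (L0 M) (L0_dist M)"


section \<open>Harmonic functions and universality\<close>

text \<open>\<open>z n\<close> is the \<open>(n+1)\<close>-st vertex of the enumeration, whence the weight \<open>2 ^ Suc n\<close>.\<close>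

definition pointwise_dist :: "(nat \<Rightarrow> 'v) \<Rightarrow> ('v \<Rightarrow> 'e::metric_space) \<Rightarrow> ('v \<Rightarrow> 'e) \<Rightarrow> real" where
  "pointwise_dist z f g = (\<Sum>n. bounded_dist (f (z n)) (g (z n)) / 2 ^ Suc n)"

definition harmonic_functions ::
    "('v \<Rightarrow> 'v \<Rightarrow> bool) \<Rightarrow> 'v \<Rightarrow> ('v \<Rightarrow> 'v \<Rightarrow> complex) \<Rightarrow> ('v \<Rightarrow> 'e::complex_normed_vector) set" where
  "harmonic_functions adj x0 w = {f. \<forall>x. f x = (\<Sum>y\<in>children adj x0 x. w x y *\<^sub>C f y)}"

definition harmonic_topology ::
    "('v \<Rightarrow> 'v \<Rightarrow> bool) \<Rightarrow> 'v \<Rightarrow> ('v \<Rightarrow> 'v \<Rightarrow> complex) \<Rightarrow> (nat \<Rightarrow> 'v) \<Rightarrow>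
      ('v \<Rightarrow> 'e::complex_normed_vector) topology" where
  "harmonic_topology adj x0 w z =
     subtopology (Metric_space.mtopology UNIV (pointwise_dist z)) (harmonic_functions adj x0 w)"

definition boundary_value ::
    "('v \<Rightarrow> 'v \<Rightarrow> bool) \<Rightarrow> 'v \<Rightarrow> nat \<Rightarrow> ('v \<Rightarrow> 'e) \<Rightarrow> 'v set \<Rightarrow> 'e" where
  "boundary_value adj x0 n f e = f (THE x. x \<in> e \<inter> level adj x0 n)"

definition upper_density :: "nat set \<Rightarrow> ereal" where
  "upper_density A = limsup (\<lambda>N. ereal (real (card (A \<inter> {1..N})) / real N))"

text \<open>
  The class of \<open>\<psi>\<close> in \<^term>\<open>L0 M\<close> is \<^term>\<open>ae_rel M `` {\<psi>}\<close>.
\<close>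

definition universal_harmonic ::
    "('v \<Rightarrow> 'v \<Rightarrow> bool) \<Rightarrow> 'v \<Rightarrow> ('v \<Rightarrow> 'v \<Rightarrow> complex) \<Rightarrow> 'v set measure \<Rightarrow>
      ('v \<Rightarrow> 'e::complex_normed_vector) set" where
  "universal_harmonic adj x0 w M = {f \<in> harmonic_functions adj x0 w.
     \<forall>V. openin (L0_topology M) V \<and> V \<noteq> {} \<longrightarrow>
       upper_density {n. 1 \<le> n \<and> ae_rel M `` {boundary_value adj x0 n f} \<in> V} = 1}"

end

theory Submission
  imports Defs
begin

text \<open>
  A harmonic function can be continued from one level to the next with arbitrary values at all
  children but one. Choosing the exceptional child to carry at most half of the mass of its parent,
  one steers a harmonic function towards a fixed target depending on finitely many levels: after
  \<open>k\<close> steps the target is attained outside a set of measure at most \<open>2\<^sup>-\<^sup>k\<close>, and from then on for as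
  long as the target is kept. Keeping each target during a stage much longer than all previous
  levels together gives upper density one.

  A sequence of functions \<open>F\<^sub>j\<close> is steered simultaneously, each of them after an initial segment
  prescribed by a dense sequence of harmonic functions, whence the \<open>F\<^sub>j\<close> are dense. In every stage only one
  of them is steered towards a nonzero target, which makes every nonzero linear combination universal.
\<close>

section \<open>Trees and the boundary measure\<close>

text \<open>Connects the paths of \<open>tree_graph\<close> with the powers of the adjacency
  relation that define distance; it shows that some walk from the root reaches each vertex.\<close>

lemma successively_relpowp:
  "xs \<noteq> [] \<Longrightarrow> successively R xs \<Longrightarrow> (R ^^ (length xs - 1)) (hd xs) (last xs)"
proof (induction xs rule: rev_induct)
  case (snoc x xs)
  show ?case
  proof (cases "xs = []")
    case False
    then have "(R ^^ (length xs - 1)) (hd xs) (last xs)" "R (last xs) x"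
      using snoc by (auto simp: successively_append_iff)
    then have "(R ^^ Suc (length xs - 1)) (hd xs) x"
      by (rule relpowp_Suc_I)
    then show ?thesis
      using False by (cases xs) auto
  qed auto
qed simp

locale boundary_tree =
  fixes adj :: "'v \<Rightarrow> 'v \<Rightarrow> bool" and x0 :: 'v
    and q :: "'v \<Rightarrow> 'v \<Rightarrow> real" and w :: "'v \<Rightarrow> 'v \<Rightarrow> complex"
    and \<mu> :: "'v set measure"
  assumes tree: "tree_graph adj"
    and finite_level: "\<And>n. finite (level adj x0 n)"
    and two_children: "\<And>x. \<exists>a\<in>children adj x0 x. \<exists>b\<in>children adj x0 x. a \<noteq> b"
    and q_pos: "\<And>x y. y \<in> children adj x0 x \<Longrightarrow> q x y > 0"
    and q_sum: "\<And>x. (\<Sum>y\<in>children adj x0 x. q x y) = 1"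
    and w_nonzero: "\<And>x y. y \<in> children adj x0 x \<Longrightarrow> w x y \<noteq> 0"
    and w_sum: "\<And>x. (\<Sum>y\<in>children adj x0 x. w x y) = 1"
    and measure: "boundary_measure adj x0 q \<mu>"
begin

abbreviation lv :: "'v \<Rightarrow> nat" where "lv \<equiv> graph_dist adj x0"
abbreviation chd :: "'v \<Rightarrow> 'v set" where "chd \<equiv> children adj x0"
abbreviation ray :: "(nat \<Rightarrow> 'v) \<Rightarrow> bool" where "ray \<equiv> is_ray adj x0"

section \<open>Levels, geodesics and parents\<close>

lemma lv_root [simp]: "lv x0 = 0"
  unfolding graph_dist_def by (rule Least_eq_0) simp

lemma relpowp_lv: "(adj ^^ lv x) x0 x"
proof -
  obtain xs where "simple_path adj x0 xs x"
    using tree unfolding tree_graph_def by metis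
  then have "\<exists>n. (adj ^^ n) x0 x"
    unfolding simple_path_def using successively_relpowp[of xs adj] by auto
  then show ?thesis
    unfolding graph_dist_def by (rule LeastI_ex)
qed

lemma lv_le: "(adj ^^ n) x0 x \<Longrightarrow> lv x \<le> n"
  unfolding graph_dist_def by (rule Least_le)

lemma lv_eq_0: "lv x = 0 \<longleftrightarrow> x = x0"
  using relpowp_lv[of x] by auto

lemma lv_child: "y \<in> chd x \<Longrightarrow> lv y = Suc (lv x)"
  by (simp add: children_def)

text \<open>The parent is the last vertex but one of a shortest walk from the root. It cannot lie on
  an earlier level, since one more step would then reach \<open>x\<close> too soon.\<close>

lemma ex_parent:
  assumes "lv x = Suc n"
  shows "\<exists>p. lv p = n \<and> x \<in> chd p"
proof -
  have "(adj ^^ Suc n) x0 x"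
    using relpowp_lv[of x] assms by simp
  then obtain p where p: "(adj ^^ n) x0 p" "adj p x"
    by (auto elim: relpowp_Suc_E)
  have "lv x \<le> Suc (lv p)"
    using relpowp_lv[of p] p(2) by (intro lv_le relpowp_Suc_I)
  with lv_le[OF p(1)] assms have "lv p = n"
    by simp
  then show ?thesis
    using p assms by (auto simp: children_def)
qed

text \<open>Going back from parent to parent yields a path along which the level rises by one at
  each step; strictly rising levels make it simple.\<close>

lemma ex_geodesic: "\<exists>xs. simple_path adj x0 xs x \<and> map lv xs = [0..<Suc (lv x)]"
proof (induction "lv x" arbitrary: x)
  case 0
  then have "x = x0" by (simp add: lv_eq_0)
  then show ?case
    by (intro exI[of _ "[x0]"]) (auto simp: simple_path_def)
next
  case (Suc n)
  then obtain p where p: "lv p = n" "x \<in> chd p"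
    using ex_parent[of x n] by auto
  then obtain xs where xs: "simple_path adj x0 xs p" "map lv xs = [0..<Suc n]"
    using Suc(1)[of p] by auto
  have m: "map lv (xs @ [x]) = [0..<Suc (lv x)]"
    using xs(2) Suc(2) by simp
  then have "distinct (map lv (xs @ [x]))"
    by (simp only: distinct_upt)
  then have "distinct (xs @ [x])"
    using distinct_map by blast
  then have "simple_path adj x0 (xs @ [x]) x"
    using xs(1) p(2) by (auto simp: simple_path_def successively_append_iff children_def)
  with m show ?case by blast
qed

text \<open>Here the uniqueness of simple paths enters: geodesics to the two parents, each prolonged
  by \<open>x\<close>, are simple paths with the same ends, so they coincide up to their last vertex
  but one.\<close>

lemma parent_unique:
  assumes "x \<in> chd p" "x \<in> chd p'"
  shows "p = p'"
proof -
  have *: "\<exists>xs. xs \<noteq> [] \<and> last xs = p \<and> simple_path adj x0 (xs @ [x]) x" if p: "x \<in> chd p" for p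
  proof -
    obtain xs where xs: "simple_path adj x0 xs p" "map lv xs = [0..<Suc (lv p)]"
      using ex_geodesic by blast
    have "map lv (xs @ [x]) = [0..<Suc (lv x)]"
      using xs(2) lv_child[OF p] by simp
    then have "distinct (map lv (xs @ [x]))"
      by (simp only: distinct_upt)
    then have "distinct (xs @ [x])"
      using distinct_map by blast
    then have "simple_path adj x0 (xs @ [x]) x"
      using xs(1) p by (auto simp: simple_path_def successively_append_iff children_def)
    then show ?thesis
      using xs(1) by (auto simp: simple_path_def)
  qed
  obtain xs ys where "last xs = p" "simple_path adj x0 (xs @ [x]) x"
      "last ys = p'" "simple_path adj x0 (ys @ [x]) x"
    using *[OF assms(1)] *[OF assms(2)] by blast
  moreover have "\<exists>!xs. simple_path adj x0 xs x"
    using tree unfolding tree_graph_def by blast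
  ultimately show ?thesis
    by (metis append1_eq_conv)
qed

definition parent :: "'v \<Rightarrow> 'v" where
  "parent x = (THE p. x \<in> chd p)"

lemma parent_eq: "x \<in> chd p \<Longrightarrow> parent x = p"
  unfolding parent_def using parent_unique by blast

lemma ex_path: "\<exists>y. y 0 = x0 \<and> (\<forall>j<lv x. y (Suc j) \<in> chd (y j)) \<and> y (lv x) = x"
proof (induction "lv x" arbitrary: x)
  case 0
  then show ?case by (intro exI[of _ "\<lambda>_. x0"]) (simp add: lv_eq_0)
next
  case (Suc n)
  then obtain p where p: "lv p = n" "x \<in> chd p"
    using ex_parent[of x n] by auto
  then obtain y where y: "y 0 = x0" "\<forall>j<n. y (Suc j) \<in> chd (y j)" "y n = p"
    using Suc(1)[of p] by auto
  show ?case
    using y p by (intro exI[of _ "y(Suc n := x)"]) (auto simp: Suc(2)[symmetric] less_Suc_eq)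
qed

lemma finite_children: "finite (chd x)"
  by (rule finite_subset[OF _ finite_level[of "Suc (lv x)"]]) (auto simp: children_def level_def)

section \<open>Rays as boundary points\<close>

lemma ray_lv: "ray y \<Longrightarrow> lv (y n) = n"
  by (induction n) (auto simp: is_ray_def children_def)

lemma ray_child: "ray y \<Longrightarrow> y (Suc n) \<in> chd (y n)"
  by (simp add: is_ray_def)

text \<open>A ray meets every level exactly once, at the index equal to the level.\<close>

lemma ray_range: "ray y \<Longrightarrow> x \<in> range y \<longleftrightarrow> y (lv x) = x"
  using ray_lv by (metis rangeE rangeI)

lemma range_in_boundary: "ray y \<Longrightarrow> range y \<in> boundary adj x0"
  by (auto simp: boundary_def)

lemma boundaryE:
  assumes "e \<in> boundary adj x0"
  obtains y where "ray y" "e = range y"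
  using assms by (auto simp: boundary_def)

lemma ray_cyl: "ray y \<Longrightarrow> range y \<in> cyl adj x0 x \<longleftrightarrow> y (lv x) = x"
  by (simp add: cyl_def range_in_boundary ray_range)

lemma boundary_value_ray:
  assumes "ray y"
  shows "boundary_value adj x0 n f (range y) = f (y n)"
proof -
  have "(THE x. x \<in> range y \<inter> level adj x0 n) = y n"
    using assms ray_lv by (intro the_equality) (auto simp: level_def)
  then show ?thesis by (simp add: boundary_value_def)
qed

section \<open>Probabilities of cylinders\<close>

lemma prob_space: "prob_space \<mu>"
  and space_eq: "space \<mu> = boundary adj x0"
  and sets_eq: "sets \<mu> = sigma_sets (boundary adj x0) (\<Union>n\<in>{1..}. level_algebra adj x0 n)"
  using measure by (auto simp: boundary_measure_def)

sublocale prob_space \<mu>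
  by (rule prob_space)

lemma cyl_root: "cyl adj x0 x0 = boundary adj x0"
proof -
  have "x0 \<in> e" if "e \<in> boundary adj x0" for e
    using that by (rule boundaryE) (simp add: is_ray_def ray_range)
  then show ?thesis by (auto simp: cyl_def)
qed

lemma sets_cyl [measurable]: "cyl adj x0 x \<in> sets \<mu>"
proof (cases "lv x = 0")
  case True
  then show ?thesis
    using sets.top[of \<mu>] by (simp add: lv_eq_0 cyl_root space_eq)
next
  case False
  have "cyl adj x0 x \<in> level_algebra adj x0 (lv x)"
    unfolding level_algebra_def by (rule sigma_sets.Basic) (auto simp: level_def)
  then show ?thesis
    unfolding sets_eq using False by (intro sigma_sets.Basic) (auto intro!: bexI[of _ "lv x"])
qed

text \<open>The assumption on the measure covers \<open>n \<ge> 1\<close>. For \<open>n = 0\<close>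
  the cylinder is the whole boundary and the empty product is its mass 1.\<close>

lemma prob_path:
  assumes "y 0 = x0" "\<forall>j<n. y (Suc j) \<in> chd (y j)"
  shows "prob (cyl adj x0 (y n)) = (\<Prod>j<n. q (y j) (y (Suc j)))"
proof (cases "n = 0")
  case True
  then show ?thesis
    using assms prob_space by (simp add: cyl_root space_eq)
next
  case False
  then show ?thesis
    using measure assms by (simp add: boundary_measure_def)
qed

lemma prob_cyl_child:
  assumes "c \<in> chd x"
  shows "prob (cyl adj x0 c) = prob (cyl adj x0 x) * q x c"
proof -
  obtain y where y: "y 0 = x0" "\<forall>j<lv x. y (Suc j) \<in> chd (y j)" "y (lv x) = x"
    using ex_path by blast
  define y' where "y' = y(Suc (lv x) := c)"
  have "prob (cyl adj x0 (y' (Suc (lv x)))) = (\<Prod>j<Suc (lv x). q (y' j) (y' (Suc j)))"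
    using y assms by (intro prob_path) (auto simp: y'_def less_Suc_eq)
  also have "\<dots> = (\<Prod>j<lv x. q (y j) (y (Suc j))) * q x c"
    using y by (auto simp: y'_def intro!: prod.cong)
  also have "(\<Prod>j<lv x. q (y j) (y (Suc j))) = prob (cyl adj x0 x)"
    using prob_path[of y "lv x"] y by simp
  finally show ?thesis by (simp add: y'_def)
qed

text \<open>A ray has one vertex per level, so the cylinders of one level are disjoint.\<close>

lemma sum_level_prob: "(\<Sum>x\<in>level adj x0 n. prob (cyl adj x0 x)) \<le> 1"
proof -
  have "disjoint_family_on (cyl adj x0) (level adj x0 n)"
    unfolding disjoint_family_on_def
  proof (intro ballI impI equals0I)
    fix x x' e
    assume *: "x \<in> level adj x0 n" "x' \<in> level adj x0 n" "x \<noteq> x'" "e \<in> cyl adj x0 x \<inter> cyl adj x0 x'"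
    then obtain y where "ray y" "e = range y"
      by (auto simp: cyl_def elim: boundaryE)
    with * show False
      by (auto simp: ray_cyl level_def)
  qed
  then have "(\<Sum>x\<in>level adj x0 n. prob (cyl adj x0 x)) = prob (\<Union>x\<in>level adj x0 n. cyl adj x0 x)"
    by (intro finite_measure_finite_Union[symmetric] finite_level) auto
  then show ?thesis by simp
qed

text \<open>
  The one child at which the target value will be sacrificed in order to restore harmonicity.
\<close>

definition light :: "'v \<Rightarrow> 'v" where
  "light x = (SOME c. c \<in> chd x \<and> q x c \<le> 1/2)"

text \<open>Two positive numbers of sum at most 1 cannot both exceed \<open>1/2\<close>; this is why
  two children are required.\<close>

lemma light: "light x \<in> chd x" "q x (light x) \<le> 1/2"
proof -
  obtain a b where ab: "a \<in> chd x" "b \<in> chd x" "a \<noteq> b"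
    using two_children by blast
  have "(\<Sum>y\<in>{a,b}. q x y) \<le> (\<Sum>y\<in>chd x. q x y)"
    using ab q_pos by (intro sum_mono2 finite_children) (auto intro: less_imp_le)
  then have "q x a + q x b \<le> 1"
    using ab q_sum by simp
  then have "q x a \<le> 1/2 \<or> q x b \<le> 1/2" by linarith
  then have "\<exists>c. c \<in> chd x \<and> q x c \<le> 1/2"
    using ab by blast
  then have "light x \<in> chd x \<and> q x (light x) \<le> 1/2"
    unfolding light_def by (rule someI_ex)
  then show "light x \<in> chd x" "q x (light x) \<le> 1/2" by auto
qed

text \<open>Rays that take the light child \<open>k\<close> times in a row pass through
  \<open>C k\<close>, the \<open>k\<close>-fold light descendants of level \<open>n\<close>, whose
  total mass is at least halved at each step. These are the only rays on which steering may not have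
  succeeded after \<open>k\<close> steps.\<close>

lemma light_rays:
  "\<exists>B\<in>sets \<mu>. prob B \<le> (1/2) ^ k \<and>
     (\<forall>y. ray y \<and> (\<forall>i<k. y (Suc (n + i)) = light (y (n + i))) \<longrightarrow> range y \<in> B)"
proof -
  define C where "C = (\<lambda>k. (light ^^ k) ` level adj x0 n)"
  have fin: "finite (C k)" for k
    unfolding C_def using finite_level by simp
  have C_Suc: "C (Suc k) = light ` C k" for k
    by (simp add: C_def image_image)
  have sum: "(\<Sum>x\<in>C k. prob (cyl adj x0 x)) \<le> (1/2) ^ k" for k
  proof (induction k)
    case 0
    then show ?case using sum_level_prob by (simp add: C_def)
  next
    case (Suc k)
    have "(\<Sum>x\<in>C (Suc k). prob (cyl adj x0 x)) \<le> (\<Sum>x\<in>C k. prob (cyl adj x0 (light x)))"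
      unfolding C_Suc using sum_image_le[OF fin, where g = "\<lambda>x. prob (cyl adj x0 x)" and f = light] by (simp add: comp_def)
    also have "\<dots> \<le> (\<Sum>x\<in>C k. prob (cyl adj x0 x) * (1/2))"
      unfolding prob_cyl_child[OF light(1)]
      by (intro sum_mono mult_left_mono light) simp
    also have "\<dots> \<le> (1/2) ^ Suc k"
      unfolding sum_distrib_right[symmetric] using Suc by simp
    finally show ?case .
  qed
  show ?thesis
  proof (intro bexI conjI allI impI)
    show "(\<Union>x\<in>C k. cyl adj x0 x) \<in> sets \<mu>"
      using fin by auto
    have "prob (\<Union>x\<in>C k. cyl adj x0 x) \<le> (\<Sum>x\<in>C k. prob (cyl adj x0 x))"
      using fin by (intro finite_measure_subadditive_finite) auto
    with sum show "prob (\<Union>x\<in>C k. cyl adj x0 x) \<le> (1/2) ^ k"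
      using order_trans by blast
  next
    fix y assume y: "ray y \<and> (\<forall>i<k. y (Suc (n + i)) = light (y (n + i)))"
    have "j \<le> k \<Longrightarrow> y (n + j) = (light ^^ j) (y n)" for j
      using y by (induction j) auto
    then have "y (n + k) \<in> C k"
      using y ray_lv by (auto simp: C_def level_def)
    moreover have "range y \<in> cyl adj x0 (y (n + k))"
      using y ray_lv by (simp add: ray_cyl)
    ultimately show "range y \<in> (\<Union>x\<in>C k. cyl adj x0 x)" by blast
  qed
qed

end


section \<open>The metrics and upper density\<close>

lemma bounded_dist_nonneg: "0 \<le> bounded_dist a b"
  and bounded_dist_le_1: "bounded_dist a b \<le> 1"
  and bounded_dist_le_dist: "bounded_dist a b \<le> dist a b"
  and bounded_dist_commute: "bounded_dist a b = bounded_dist b a"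
  and bounded_dist_eq_0: "bounded_dist a b = 0 \<longleftrightarrow> a = b"
proof -
  have *: "0 < 1 + dist a b" using zero_le_dist[of a b] by linarith
  show "0 \<le> bounded_dist a b" by (simp add: bounded_dist_def)
  show "bounded_dist a b \<le> 1" using * by (simp add: bounded_dist_def)
  show "bounded_dist a b \<le> dist a b"
    using * by (simp add: bounded_dist_def divide_le_eq mult_left_mono distrib_left)
  show "bounded_dist a b = bounded_dist b a" by (simp add: bounded_dist_def dist_commute)
  show "bounded_dist a b = 0 \<longleftrightarrow> a = b" using * by (simp add: bounded_dist_def)
qed

text \<open>The function \<open>x / (1 + x)\<close> is increasing, and it is subadditive because
  splitting the numerator allows each denominator to shrink.\<close>

lemma bounded_dist_triangle: "bounded_dist a c \<le> bounded_dist a b + bounded_dist b c"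
proof -
  have "x / (1 + x) \<le> y / (1 + y) + z / (1 + z)" if "0 \<le> x" "0 \<le> y" "0 \<le> z" "x \<le> y + z" for x y z :: real
  proof -
    have "x / (1 + x) \<le> (y + z) / (1 + (y + z))"
      using that by (simp add: frac_le_eq divide_le_0_iff) (simp add: field_simps)
    also have "\<dots> = y / (1 + (y + z)) + z / (1 + (y + z))"
      by (rule add_divide_distrib)
    also have "\<dots> \<le> y / (1 + y) + z / (1 + z)"
      using that by (intro add_mono divide_left_mono) auto
    finally show ?thesis .
  qed
  then show ?thesis
    unfolding bounded_dist_def by (simp add: dist_triangle)
qed

text \<open>As a sequence, the dense set lets points of the space be coded by natural numbers:
  targets become functions from vertices to indices.\<close>

lemma separable_dense_sequence:
  assumes "separable_space (euclidean :: 'e::metric_space topology)"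
  obtains d :: "nat \<Rightarrow> 'e::metric_space" where "\<And>a \<epsilon>. 0 < \<epsilon> \<Longrightarrow> \<exists>k. dist a (d k) < \<epsilon>"
proof -
  obtain C :: "'e set" where C: "countable C" "closure C = UNIV"
    using assms unfolding separable_space_def by auto
  have "C \<noteq> {}" using C by auto
  then have "range (from_nat_into C) = C"
    using C by simp
  have "\<exists>k. dist a (from_nat_into C k) < \<epsilon>" if "0 < \<epsilon>" for a \<epsilon>
  proof -
    have "a \<in> closure C" using C by simp
    then obtain c where "c \<in> C" "dist c a < \<epsilon>"
      using \<open>0 < \<epsilon>\<close> by (auto simp: closure_approachable)
    then show ?thesis
      using \<open>range (from_nat_into C) = C\<close> by (metis dist_commute rangeE)
  qed
  then show ?thesis using that by blast
qed

text \<open>A distance is below \<open>a\<close> exactly if some detour through a point of the dense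
  sequence is shorter than \<open>a\<close>. This reduces the claim to countably many distances to
  fixed points.\<close>

lemma borel_measurable_dist_separable:
  fixes f g :: "'a \<Rightarrow> 'e::metric_space"
  assumes sep: "separable_space (euclidean :: 'e topology)"
    and f [measurable]: "f \<in> borel_measurable M" and g [measurable]: "g \<in> borel_measurable M"
  shows "(\<lambda>x. dist (f x) (g x)) \<in> borel_measurable M"
proof -
  obtain d :: "nat \<Rightarrow> 'e" where d: "\<And>a \<epsilon>. 0 < \<epsilon> \<Longrightarrow> \<exists>k. dist a (d k) < \<epsilon>"
    using separable_dense_sequence[OF sep] by blast
  have [measurable]: "(\<lambda>x. dist (f x) c) \<in> borel_measurable M" "(\<lambda>x. dist (g x) c) \<in> borel_measurable M" for c
    by (auto intro!: measurable_compose[OF f] measurable_compose[OF g] borel_measurable_continuous_onI continuous_intros)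
  have "{x \<in> space M. dist (f x) (g x) < a} \<in> sets M" for a
  proof -
    have "\<exists>k. dist (f x) (d k) + dist (g x) (d k) < a" if less: "dist (f x) (g x) < a" for x
    proof -
      obtain k where "dist (g x) (d k) < (a - dist (f x) (g x)) / 2"
        using d[of "(a - dist (f x) (g x)) / 2" "g x"] less by auto
      moreover have "dist (f x) (d k) \<le> dist (f x) (g x) + dist (g x) (d k)"
        by (rule dist_triangle)
      ultimately show ?thesis by (intro exI[of _ k]) (simp add: field_simps)
    qed
    moreover have "dist (f x) (g x) < a" if "dist (f x) (d k) + dist (g x) (d k) < a" for x k
      using that dist_triangle2[of "f x" "g x" "d k"] by linarith
    ultimately have "{x \<in> space M. dist (f x) (g x) < a}
        = {x \<in> space M. \<exists>k. dist (f x) (d k) + dist (g x) (d k) < a}"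
      by blast
    also have "\<dots> \<in> sets M" by measurable
    finally show ?thesis .
  qed
  then show ?thesis by (simp add: borel_measurable_iff_less)
qed

section \<open>The metric of convergence in probability\<close>

lemma equiv_ae_rel: "equiv (borel_measurable M) (ae_rel M)"
proof (rule equivI)
  show "sym (ae_rel M)"
    by (auto simp: sym_def ae_rel_def elim: AE_mp)
  show "trans (ae_rel M)"
    unfolding trans_def ae_rel_def by (auto elim: AE_mp intro: AE_mp)
qed (auto simp: ae_rel_def refl_on_def)

context
  fixes M :: "'a measure"
  assumes prob: "prob_space M" and sep: "separable_space (euclidean :: 'e::metric_space topology)"
begin

interpretation prob_space M by (rule prob)

lemma integrable_bounded_dist:
  fixes \<psi> \<phi> :: "'a \<Rightarrow> 'e"
  assumes "\<psi> \<in> borel_measurable M" "\<phi> \<in> borel_measurable M"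
  shows "integrable M (\<lambda>e. bounded_dist (\<psi> e) (\<phi> e))"
proof (rule integrable_const_bound[where B = 1])
  have [measurable]: "(\<lambda>e. dist (\<psi> e) (\<phi> e)) \<in> borel_measurable M"
    by (rule borel_measurable_dist_separable[OF sep assms])
  show "(\<lambda>e. bounded_dist (\<psi> e) (\<phi> e)) \<in> borel_measurable M"
    unfolding bounded_dist_def by measurable
qed (simp add: bounded_dist_nonneg bounded_dist_le_1)

lemma L0_some:
  fixes \<psi> :: "'a \<Rightarrow> 'e"
  assumes "\<psi> \<in> borel_measurable M"
  shows "(\<psi>, SOME \<psi>'. \<psi>' \<in> ae_rel M `` {\<psi>}) \<in> ae_rel M"
proof -
  have "\<psi> \<in> ae_rel M `` {\<psi>}" using assms by (simp add: ae_rel_def)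
  then have "(SOME \<psi>'. \<psi>' \<in> ae_rel M `` {\<psi>}) \<in> ae_rel M `` {\<psi>}"
    by (rule someI[where P = "\<lambda>\<psi>'. \<psi>' \<in> ae_rel M `` {\<psi>}"])
  then show ?thesis by simp
qed

text \<open>\<open>L0_dist\<close> evaluates representatives picked by \<open>SOME\<close>; another
  choice changes the integrand only on a null set.\<close>

lemma L0_dist_class:
  fixes \<psi> \<phi> :: "'a \<Rightarrow> 'e"
  assumes "\<psi> \<in> borel_measurable M" "\<phi> \<in> borel_measurable M"
  shows "L0_dist M (ae_rel M `` {\<psi>}) (ae_rel M `` {\<phi>}) = (\<integral>e. bounded_dist (\<psi> e) (\<phi> e) \<partial>M)"
proof -
  define \<psi>' where "\<psi>' = (SOME \<psi>'. \<psi>' \<in> ae_rel M `` {\<psi>})"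
  define \<phi>' where "\<phi>' = (SOME \<phi>'. \<phi>' \<in> ae_rel M `` {\<phi>})"
  have "(\<psi>, \<psi>') \<in> ae_rel M" "(\<phi>, \<phi>') \<in> ae_rel M"
    unfolding \<psi>'_def \<phi>'_def using assms by (simp_all only: L0_some)
  then have *: "AE e in M. \<psi> e = \<psi>' e" "AE e in M. \<phi> e = \<phi>' e"
      "\<psi>' \<in> borel_measurable M" "\<phi>' \<in> borel_measurable M"
    by (simp_all add: ae_rel_def)
  have "AE e in M. bounded_dist (\<psi>' e) (\<phi>' e) = bounded_dist (\<psi> e) (\<phi> e)"
    using *(1,2) by eventually_elim simp
  then show ?thesis
    unfolding L0_dist_def \<psi>'_def[symmetric] \<phi>'_def[symmetric]
    by (intro integral_cong_AE borel_measurable_integrable integrable_bounded_dist * assms)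
qed

lemma L0_class: "\<psi> \<in> borel_measurable M \<Longrightarrow> ae_rel M `` {\<psi>} \<in> L0 M"
  for \<psi> :: "'a \<Rightarrow> 'e"
  unfolding L0_def by (rule quotientI)

lemma Metric_space_L0: "Metric_space (L0 M :: ('a \<Rightarrow> 'e) set set) (L0_dist M)"
proof
  fix A B C :: "('a \<Rightarrow> 'e) set"
  show "0 \<le> L0_dist M A B"
    unfolding L0_dist_def by (intro Bochner_Integration.integral_nonneg bounded_dist_nonneg)
  show "L0_dist M A B = L0_dist M B A"
    unfolding L0_dist_def by (simp add: bounded_dist_commute)
  assume "A \<in> L0 M" "B \<in> L0 M"
  then obtain \<psi> \<phi> where A: "A = ae_rel M `` {\<psi>}" "\<psi> \<in> borel_measurable M"
      and B: "B = ae_rel M `` {\<phi>}" "\<phi> \<in> borel_measurable M"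
    unfolding L0_def by (auto elim!: quotientE)
  have "L0_dist M A B = 0 \<longleftrightarrow> (AE e in M. bounded_dist (\<psi> e) (\<phi> e) = 0)"
    unfolding A(1) B(1) L0_dist_class[OF A(2) B(2)]
    by (intro integral_nonneg_eq_0_iff_AE integrable_bounded_dist A B) (simp add: bounded_dist_nonneg)
  also have "\<dots> \<longleftrightarrow> (\<psi>, \<phi>) \<in> ae_rel M"
    using A B by (simp add: bounded_dist_eq_0 ae_rel_def)
  also have "\<dots> \<longleftrightarrow> A = B"
    unfolding A(1) B(1) using equiv_ae_rel A B by (metis eq_equiv_class_iff)
  finally show "L0_dist M A B = 0 \<longleftrightarrow> A = B" .
  assume "C \<in> L0 M"
  then obtain \<theta> where C: "C = ae_rel M `` {\<theta>}" "\<theta> \<in> borel_measurable M"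
    unfolding L0_def by (auto elim!: quotientE)
  have "(\<integral>e. bounded_dist (\<psi> e) (\<theta> e) \<partial>M) \<le> (\<integral>e. bounded_dist (\<psi> e) (\<phi> e) + bounded_dist (\<phi> e) (\<theta> e) \<partial>M)"
    by (intro integral_mono Bochner_Integration.integrable_add integrable_bounded_dist A B C bounded_dist_triangle)
  also have "\<dots> = (\<integral>e. bounded_dist (\<psi> e) (\<phi> e) \<partial>M) + (\<integral>e. bounded_dist (\<phi> e) (\<theta> e) \<partial>M)"
    by (intro Bochner_Integration.integral_add integrable_bounded_dist A B C)
  finally show "L0_dist M A C \<le> L0_dist M A B + L0_dist M B C"
    unfolding A(1) B(1) C(1) L0_dist_class[OF A(2) B(2)] L0_dist_class[OF B(2) C(2)]
      L0_dist_class[OF A(2) C(2)] .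
qed

text \<open>The integrand is at most \<open>\<delta>\<close> outside \<open>B\<close> and at most 1
  on \<open>B\<close>, so large deviations cost no more than the measure of the set where they
  occur.\<close>

lemma L0_dist_le:
  fixes \<psi> \<phi> :: "'a \<Rightarrow> 'e"
  assumes "\<psi> \<in> borel_measurable M" "\<phi> \<in> borel_measurable M" "B \<in> sets M" "0 \<le> \<delta>"
    and "\<And>e. e \<in> space M \<Longrightarrow> e \<notin> B \<Longrightarrow> dist (\<psi> e) (\<phi> e) \<le> \<delta>"
  shows "L0_dist M (ae_rel M `` {\<psi>}) (ae_rel M `` {\<phi>}) \<le> \<delta> + measure M B"
proof -
  have "(\<integral>e. bounded_dist (\<psi> e) (\<phi> e) \<partial>M) \<le> (\<integral>e. \<delta> + indicator B e \<partial>M)"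
  proof (rule integral_mono)
    show "integrable M (\<lambda>e. \<delta> + indicat_real B e)"
      using assms by (auto simp: emeasure_eq_measure)
    show "bounded_dist (\<psi> e) (\<phi> e) \<le> \<delta> + indicator B e" if "e \<in> space M" for e
      using assms(4) assms(5)[OF that] bounded_dist_le_dist[of "\<psi> e" "\<phi> e"]
        bounded_dist_le_1[of "\<psi> e" "\<phi> e"] by (cases "e \<in> B") auto
  qed (intro integrable_bounded_dist assms)
  also have "\<dots> = \<delta> + measure M B"
    using assms(3) by (subst Bochner_Integration.integral_add) (auto simp: emeasure_eq_measure prob_space)
  finally show ?thesis using L0_dist_class[OF assms(1,2)] by simp
qed

end

section \<open>The metric of pointwise convergence\<close>

lemma summable_pointwise_dist: "summable (\<lambda>n. bounded_dist (f (z n)) (g (z n)) / 2 ^ Suc n)"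
proof (rule summable_comparison_test')
  show "summable (\<lambda>n. (1/2::real) ^ Suc n)"
    using power_half_series by (rule sums_summable)
  show "norm (bounded_dist (f (z n)) (g (z n)) / 2 ^ Suc n) \<le> (1/2) ^ Suc n" for n
    using bounded_dist_nonneg[of "f (z n)" "g (z n)"] bounded_dist_le_1[of "f (z n)" "g (z n)"]
    by (simp add: field_simps)
qed

text \<open>Surjectivity of \<open>z\<close> makes distance zero imply equality; the other axioms
  hold termwise.\<close>

lemma Metric_space_pointwise_dist:
  assumes "bij z"
  shows "Metric_space UNIV (pointwise_dist z)"
proof
  fix f g h :: "'a \<Rightarrow> 'b"
  show "0 \<le> pointwise_dist z f g"
    unfolding pointwise_dist_def
    by (intro suminf_nonneg summable_pointwise_dist) (simp add: bounded_dist_nonneg)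
  show "pointwise_dist z f g = pointwise_dist z g f"
    unfolding pointwise_dist_def by (simp add: bounded_dist_commute)
  have "pointwise_dist z f g = 0 \<longleftrightarrow> (\<forall>n. bounded_dist (f (z n)) (g (z n)) / 2 ^ Suc n = 0)"
    unfolding pointwise_dist_def
    by (intro suminf_eq_zero_iff summable_pointwise_dist) (simp add: bounded_dist_nonneg)
  also have "\<dots> \<longleftrightarrow> f = g"
    using assms by (simp add: bounded_dist_eq_0 fun_eq_iff) (metis bij_pointE)
  finally show "pointwise_dist z f g = 0 \<longleftrightarrow> f = g" .
  show "pointwise_dist z f h \<le> pointwise_dist z f g + pointwise_dist z g h"
    unfolding pointwise_dist_def
    by (subst suminf_add[OF summable_pointwise_dist summable_pointwise_dist])
       (intro suminf_le summable_add summable_pointwise_dist,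
        auto simp: add_divide_distrib[symmetric] intro!: divide_right_mono bounded_dist_triangle)
qed

text \<open>All terms from index \<open>N\<close> on together contribute at most
  \<open>(1/2) ^ N\<close>, so approximation at finitely many vertices suffices for density.\<close>

lemma pointwise_dist_le:
  assumes "\<And>n. n < N \<Longrightarrow> dist (f (z n)) (g (z n)) \<le> \<delta>" "0 \<le> \<delta>"
  shows "pointwise_dist z f g \<le> \<delta> + (1/2) ^ N"
proof -
  define t where "t = (\<lambda>n. bounded_dist (f (z n)) (g (z n)) / 2 ^ Suc n)"
  have half: "summable (\<lambda>n. (1/2::real) ^ Suc n)" "(\<Sum>n. (1/2::real) ^ Suc n) = 1"
    using power_half_series by (auto simp: sums_iff)
  have t: "summable t"
    unfolding t_def by (rule summable_pointwise_dist)
  have "(\<Sum>n<N. t n) \<le> (\<Sum>n<N. \<delta> * (1/2) ^ Suc n)"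
  proof (rule sum_mono)
    fix n assume "n \<in> {..<N}"
    then have "bounded_dist (f (z n)) (g (z n)) \<le> \<delta>"
      using assms(1)[of n] bounded_dist_le_dist[of "f (z n)" "g (z n)"] by simp
    then show "t n \<le> \<delta> * (1/2) ^ Suc n" by (simp add: t_def power_divide divide_right_mono)
  qed
  also have "\<dots> = \<delta> * (\<Sum>n<N. (1/2) ^ Suc n)" by (simp add: sum_distrib_left)
  also have "\<dots> \<le> \<delta> * 1"
    using sum_le_suminf[OF half(1), of "{..<N}"] half(2) assms(2) by (intro mult_left_mono) auto
  finally have head: "(\<Sum>n<N. t n) \<le> \<delta>" by simp
  have "(\<Sum>n. t (n + N)) \<le> (\<Sum>n. (1/2) ^ N * (1/2) ^ Suc n)"
  proof (rule suminf_le)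
    show "summable (\<lambda>n. t (n + N))" using t by (simp add: summable_iff_shift)
    show "summable (\<lambda>n. (1/2::real) ^ N * (1/2) ^ Suc n)" using half(1) by (rule summable_mult)
    show "t (n + N) \<le> (1/2) ^ N * (1/2) ^ Suc n" for n
      using bounded_dist_le_1[of "f (z (n + N))" "g (z (n + N))"]
      by (simp add: t_def power_divide power_add field_simps)
  qed
  also have "\<dots> = (1/2) ^ N"
    using suminf_mult[OF half(1), of "(1/2) ^ N"] half(2) by simp
  finally have "(\<Sum>n. t (n + N)) \<le> (1/2) ^ N" .
  with head show ?thesis
    unfolding pointwise_dist_def t_def[symmetric]
    using suminf_split_initial_segment[OF t, of N] by simp
qed

text \<open>It is enough to find good proportions at arbitrarily late moments; they will be found at
  the ends of long stages.\<close>

lemma upper_density_eq_1: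
  assumes "\<And>\<epsilon> N0. 0 < \<epsilon> \<Longrightarrow> \<exists>N\<ge>N0. 1 - \<epsilon> \<le> real (card (A \<inter> {1..N})) / real N"
  shows "upper_density A = 1"
proof (rule antisym)
  have "real (card (A \<inter> {1..N})) / real N \<le> 1" for N
    using card_mono[of "{1..N}" "A \<inter> {1..N}"] by (cases "N = 0") (auto simp: divide_le_eq)
  then show "upper_density A \<le> 1"
    unfolding upper_density_def by (intro Limsup_bounded) (auto simp: one_ereal_def)
  show "1 \<le> upper_density A"
    unfolding upper_density_def limsup_INF_SUP
  proof (intro INF_greatest)
    fix n
    show "1 \<le> (SUP N\<in>{n..}. ereal (real (card (A \<inter> {1..N})) / real N))"
    proof (rule ereal_le_epsilon2)
      fix \<epsilon> :: real assume "0 < \<epsilon>"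
      then obtain N where "N \<ge> n" "1 - \<epsilon> \<le> real (card (A \<inter> {1..N})) / real N"
        using assms by blast
      then have "1 \<le> ereal (real (card (A \<inter> {1..N})) / real N) + ereal \<epsilon>"
        by (simp add: one_ereal_def)
      also have "\<dots> \<le> (SUP N\<in>{n..}. ereal (real (card (A \<inter> {1..N})) / real N)) + ereal \<epsilon>"
        using \<open>N \<ge> n\<close> by (intro add_right_mono SUP_upper) auto
      finally show "1 \<le> (SUP N\<in>{n..}. ereal (real (card (A \<inter> {1..N})) / real N)) + ereal \<epsilon>" .
    qed
  qed
qed


section \<open>Approximation by functions of finitely many levels\<close>

context boundary_tree
begin

abbreviation \<P> :: "'v set measure" where "\<P> \<equiv> completion \<mu>"

sublocale C: prob_space \<P>
  by (rule prob_spaceI) (simp add: emeasure_space_1)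

text \<open>Such a function represents on vertices a boundary function that depends on the first
  \<open>L\<close> levels only. At levels smaller than \<open>L\<close> its values are free.\<close>

definition ev_const :: "nat \<Rightarrow> ('v \<Rightarrow> 'b) \<Rightarrow> bool" where
  "ev_const L f \<longleftrightarrow> (\<forall>x y. L \<le> lv x \<longrightarrow> y \<in> chd x \<longrightarrow> f y = f x)"

lemma ev_const_ray:
  assumes "ev_const L f" "ray y" "L \<le> m"
  shows "f (y m) = f (y L)"
  using assms(3)
proof (induction m rule: dec_induct)
  case (step n)
  have "f (y (Suc n)) = f (y n)"
    using assms(1,2) ray_lv[OF assms(2), of n] ray_child[OF assms(2), of n] step(1)
    by (simp add: ev_const_def)
  with step show ?case by simp
qed simp

text \<open>Agreement off a small set is exact rather than up to an error. The codomain therefore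
  needs no structure, and the notion is stable under composition with any map.\<close>

definition approximable :: "('v set \<Rightarrow> 'b) \<Rightarrow> bool" where
  "approximable g \<longleftrightarrow> (\<forall>\<epsilon>>0. \<exists>L v. \<exists>B\<in>sets \<P>. ev_const L v \<and> C.prob B < \<epsilon> \<and>
     (\<forall>y m. ray y \<longrightarrow> range y \<notin> B \<longrightarrow> L \<le> m \<longrightarrow> g (range y) = v (y m)))"

lemma approximable_compose:
  assumes "approximable g"
  shows "approximable (\<lambda>e. f (g e))"
  unfolding approximable_def
proof (intro allI impI)
  fix \<epsilon> :: real assume "0 < \<epsilon>"
  from assms this obtain L v B where "ev_const L v" "B \<in> sets \<P>" "C.prob B < \<epsilon>"
    "\<forall>y m. ray y \<longrightarrow> range y \<notin> B \<longrightarrow> L \<le> m \<longrightarrow> g (range y) = v (y m)"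
    unfolding approximable_def by blast
  then show "\<exists>L v. \<exists>B\<in>sets \<P>. ev_const L v \<and> C.prob B < \<epsilon> \<and>
     (\<forall>y m. ray y \<longrightarrow> range y \<notin> B \<longrightarrow> L \<le> m \<longrightarrow> f (g (range y)) = v (y m))"
    by (intro exI[of _ L] exI[of _ "\<lambda>x. f (v x)"] bexI[of _ B]) (auto simp: ev_const_def)
qed

lemma approximable_Pair:
  assumes "approximable g" "approximable h"
  shows "approximable (\<lambda>e. (g e, h e))"
  unfolding approximable_def
proof (intro allI impI)
  fix \<epsilon> :: real assume "0 < \<epsilon>"
  then have "0 < \<epsilon> / 2" by simp
  obtain L v B where 1: "ev_const L v" "B \<in> sets \<P>" "C.prob B < \<epsilon> / 2"
    "\<forall>y m. ray y \<longrightarrow> range y \<notin> B \<longrightarrow> L \<le> m \<longrightarrow> g (range y) = v (y m)"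
    using assms(1) \<open>0 < \<epsilon> / 2\<close> unfolding approximable_def by blast
  obtain L' v' B' where 2: "ev_const L' v'" "B' \<in> sets \<P>" "C.prob B' < \<epsilon> / 2"
    "\<forall>y m. ray y \<longrightarrow> range y \<notin> B' \<longrightarrow> L' \<le> m \<longrightarrow> h (range y) = v' (y m)"
    using assms(2) \<open>0 < \<epsilon> / 2\<close> unfolding approximable_def by blast
  have "C.prob (B \<union> B') < \<epsilon>"
    using measure_Un_le[OF 1(2) 2(2)] 1(3) 2(3) by simp
  moreover have "ev_const (max L L') (\<lambda>x. (v x, v' x))"
    using 1(1) 2(1) by (simp add: ev_const_def)
  moreover have "\<forall>y m. ray y \<longrightarrow> range y \<notin> B \<union> B' \<longrightarrow> max L L' \<le> m \<longrightarrow>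
      (g (range y), h (range y)) = (v (y m), v' (y m))"
    using 1(4) 2(4) by simp
  moreover have "B \<union> B' \<in> sets \<P>"
    using 1(2) 2(2) by (rule sets.Un)
  ultimately show "\<exists>L v. \<exists>B\<in>sets \<P>. ev_const L v \<and> C.prob B < \<epsilon> \<and>
     (\<forall>y m. ray y \<longrightarrow> range y \<notin> B \<longrightarrow> L \<le> m \<longrightarrow> (g (range y), h (range y)) = v (y m))"
    by (intro exI[of _ "max L L'"] exI[of _ "\<lambda>x. (v x, v' x)"] bexI[of _ "B \<union> B'"] conjI)
qed

lemma approximable_const: "approximable (\<lambda>e. c)"
  unfolding approximable_def
  by (intro allI impI exI[of _ "0::nat"] exI[of _ "\<lambda>_::'v. c"] bexI[of _ "{}"] conjI)
     (simp_all add: ev_const_def)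

text \<open>Bundles finitely many functions into one list, so that
  \<open>approximable_compose\<close> then applies to any function of all of them.\<close>

lemma approximable_map:
  fixes K :: nat
  assumes "\<And>k. approximable (g k)"
  shows "approximable (\<lambda>e. map (\<lambda>k. g k e) [0..<K])"
proof (induction K)
  case (Suc K)
  have "approximable (\<lambda>e. (\<lambda>(l, a). l @ [a]) (map (\<lambda>k. g k e) [0..<K], g K e))"
    by (rule approximable_compose[OF approximable_Pair[OF Suc assms]])
  then show ?case by simp
qed (simp add: approximable_const)

lemma approximable_modify:
  assumes "\<And>\<epsilon>. 0 < \<epsilon> \<Longrightarrow> \<exists>h. \<exists>B\<in>sets \<P>. approximable h \<and> C.prob B < \<epsilon> \<and>
    (\<forall>e\<in>boundary adj x0 - B. g e = h e)"
  shows "approximable g"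
  unfolding approximable_def
proof (intro allI impI)
  fix \<epsilon> :: real assume "0 < \<epsilon>"
  then have "0 < \<epsilon> / 2" by simp
  then obtain h B where 1: "B \<in> sets \<P>" "approximable h" "C.prob B < \<epsilon> / 2"
      "\<And>e. e \<in> boundary adj x0 - B \<Longrightarrow> g e = h e"
    using assms by meson
  obtain L v B' where 2: "ev_const L v" "B' \<in> sets \<P>" "C.prob B' < \<epsilon> / 2"
    "\<forall>y m. ray y \<longrightarrow> range y \<notin> B' \<longrightarrow> L \<le> m \<longrightarrow> h (range y) = v (y m)"
    using 1(2) \<open>0 < \<epsilon> / 2\<close> unfolding approximable_def by blast
  have "C.prob (B \<union> B') < \<epsilon>"
    using measure_Un_le[OF 1(1) 2(2)] 1(3) 2(3) by simp
  then show "\<exists>L v. \<exists>B\<in>sets \<P>. ev_const L v \<and> C.prob B < \<epsilon> \<and>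
     (\<forall>y m. ray y \<longrightarrow> range y \<notin> B \<longrightarrow> L \<le> m \<longrightarrow> g (range y) = v (y m))"
    using 1 2 range_in_boundary
    by (intro exI[of _ L] exI[of _ v] bexI[of _ "B \<union> B'"]) auto
qed

text \<open>Continuity of the measure from below, along the increasing finite unions.\<close>

lemma prob_small_tail:
  fixes A :: "nat \<Rightarrow> 'v set set"
  assumes "\<And>k. A k \<in> sets \<P>" "0 < \<epsilon>"
  obtains K where "C.prob ((\<Union>k. A k) - (\<Union>k<K. A k)) < \<epsilon>"
proof -
  have "(\<lambda>K. C.prob (\<Union>k<K. A k)) \<longlonglongrightarrow> C.prob (\<Union>K. \<Union>k<K. A k)"
  proof (rule C.finite_Lim_measure_incseq)
    show "range (\<lambda>K. \<Union>k<K. A k) \<subseteq> sets \<P>" using assms by auto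
    show "incseq (\<lambda>K. \<Union>k<K. A k)" unfolding incseq_def by (intro allI impI UN_mono) auto
  qed
  moreover have "(\<Union>K. \<Union>k<K. A k) = (\<Union>k. A k)" by blast
  ultimately have "\<forall>\<^sub>F K in sequentially. C.prob (\<Union>k. A k) - \<epsilon> < C.prob (\<Union>k<K. A k)"
    using assms(2) by (intro order_tendstoD) auto
  then obtain K where "C.prob (\<Union>k. A k) - \<epsilon> < C.prob (\<Union>k<K. A k)"
    by (auto simp: eventually_sequentially)
  moreover have "C.prob ((\<Union>k. A k) - (\<Union>k<K. A k)) = C.prob (\<Union>k. A k) - C.prob (\<Union>k<K. A k)"
    using assms by (intro C.finite_measure_Diff) auto
  ultimately show ?thesis using that[of K] by simp
qed

text \<open>Induction over the generated sets. A countable union is replaced by a finite one up to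
  small measure, which is why measurability is carried through the induction.\<close>

lemma approximable_sigma_sets:
  assumes "A \<in> sigma_sets (boundary adj x0) G"
    and "\<And>X. X \<in> G \<Longrightarrow> X \<in> sets \<P> \<and> approximable (\<lambda>e. e \<in> X)"
  shows "A \<in> sets \<P> \<and> approximable (\<lambda>e. e \<in> A)"
  using assms(1)
proof induction
  case (Basic a)
  with assms(2) show ?case .
next
  case Empty
  show ?case by (simp add: approximable_const)
next
  case (Compl a)
  have "approximable (\<lambda>e. e \<in> boundary adj x0 - a)"
  \<comment> \<open>Negated membership equals membership in the complement only within the boundary,
    which is all that \<open>approximable_modify\<close> demands.\<close>
  proof (rule approximable_modify)
    fix \<epsilon> :: real assume "0 < \<epsilon>"
    then show "\<exists>h. \<exists>B\<in>sets \<P>. approximable h \<and> C.prob B < \<epsilon> \<and>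
       (\<forall>e\<in>boundary adj x0 - B. (e \<in> boundary adj x0 - a) = h e)"
      using Compl approximable_compose[of "\<lambda>e. e \<in> a" Not]
      by (intro exI[of _ "\<lambda>e. e \<notin> a"] bexI[of _ "{}"]) auto
  qed
  moreover have "boundary adj x0 - a \<in> sets \<P>"
    using Compl sets.compl_sets[of a \<P>] by (simp add: space_eq)
  ultimately show ?case by simp
next
  case (Union A)
  have "approximable (\<lambda>e. e \<in> (\<Union>k. A k))"
  proof (rule approximable_modify)
    fix \<epsilon> :: real assume "0 < \<epsilon>"
    with Union obtain K where K: "C.prob ((\<Union>k. A k) - (\<Union>k<K. A k)) < \<epsilon>"
      using prob_small_tail[of A \<epsilon>] by blast
    \<comment> \<open>The finite disjunction, written as a function of a list of truth
      values.\<close>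
    have "approximable (\<lambda>e. True \<in> set (map (\<lambda>k. e \<in> A k) [0..<K]))"
      using Union by (intro approximable_compose[OF approximable_map]) blast
    moreover have "(\<lambda>e. True \<in> set (map (\<lambda>k. e \<in> A k) [0..<K])) = (\<lambda>e. \<exists>k<K. e \<in> A k)"
      by (auto simp: fun_eq_iff)
    ultimately show "\<exists>h. \<exists>B\<in>sets \<P>. approximable h \<and> C.prob B < \<epsilon> \<and>
       (\<forall>e\<in>boundary adj x0 - B. (e \<in> (\<Union>k. A k)) = h e)"
      using Union K
      by (intro exI[of _ "\<lambda>e. \<exists>k<K. e \<in> A k"] bexI[of _ "(\<Union>k. A k) - (\<Union>k<K. A k)"]) auto
  qed
  with Union show ?case by auto
qed

lemma approximable_cyl: "approximable (\<lambda>e. e \<in> cyl adj x0 x)"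
  unfolding approximable_def
proof (intro allI impI)
  \<comment> \<open>\<open>P u\<close> says that \<open>u\<close> is \<open>x\<close> or a
    descendant of \<open>x\<close>. A ray decides this at level \<open>lv x\<close> once and for
    all, so no exceptional set is needed.\<close>
  define P where "P = (\<lambda>a b. b \<in> chd a)\<^sup>*\<^sup>* x"
  have lv_P: "lv x \<le> lv u \<and> (lv u = lv x \<longrightarrow> u = x)" if "P u" for u
    using that unfolding P_def by induction (auto simp: lv_child)
  have ev: "ev_const (lv x) P"
    unfolding ev_const_def
  proof (intro allI impI iffI)
    fix u v assume "lv x \<le> lv u" "v \<in> chd u"
    { assume "P u"
      with \<open>v \<in> chd u\<close> show "P v"
        unfolding P_def by (rule rtranclp.rtrancl_into_rtrancl[rotated])
    next
      assume "P v"
      \<comment> \<open>The first case is impossible since \<open>v\<close> lies on a later level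
        than \<open>x\<close>; in the second, uniqueness of parents gives
        \<open>p = u\<close>.\<close>
      then have "v = x \<or> (\<exists>p. P p \<and> v \<in> chd p)"
        unfolding P_def by (metis rtranclp.cases)
      then show "P u"
        using \<open>lv x \<le> lv u\<close> lv_child[OF \<open>v \<in> chd u\<close>] parent_unique[OF \<open>v \<in> chd u\<close>] by auto
    }
  qed
  fix \<epsilon> :: real assume "0 < \<epsilon>"
  have "range y \<in> cyl adj x0 x \<longleftrightarrow> P (y m)" if "ray y" "lv x \<le> m" for y m
  proof -
    have "P (y m) = P (y (lv x))" by (rule ev_const_ray[OF ev that])
    also have "\<dots> \<longleftrightarrow> y (lv x) = x"
      using lv_P ray_lv[OF that(1), of "lv x"] by (auto simp: P_def)
    finally show ?thesis using that by (simp add: ray_cyl)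
  qed
  with ev \<open>0 < \<epsilon>\<close> show "\<exists>L v. \<exists>B\<in>sets \<P>. ev_const L v \<and> C.prob B < \<epsilon> \<and>
     (\<forall>y m. ray y \<longrightarrow> range y \<notin> B \<longrightarrow> L \<le> m \<longrightarrow> (range y \<in> cyl adj x0 x) = v (y m))"
    by (intro exI[of _ "lv x"] exI[of _ P] bexI[of _ "{}"]) auto
qed

text \<open>A set of the completion differs from a set of the uncompleted algebra only within a null
  set, which serves as exceptional set.\<close>

lemma approximable_sets:
  assumes "A \<in> sets \<P>"
  shows "approximable (\<lambda>e. e \<in> A)"
proof -
  obtain S N N' where S: "A = S \<union> N" "N \<subseteq> N'" "N' \<in> null_sets \<mu>" "S \<in> sets \<mu>"
    using assms by (rule sets_completionE)
  \<comment> \<open>The induction is used twice: within one level algebra, starting from cylinders,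
    and then for the algebra generated by all of them.\<close>
  have level: "X \<in> sets \<P> \<and> approximable (\<lambda>e. e \<in> X)" if "X \<in> level_algebra adj x0 n" for X n
    using that unfolding level_algebra_def
    by (rule approximable_sigma_sets) (auto intro: approximable_cyl)
  have "approximable (\<lambda>e. e \<in> S)"
    using S(4) unfolding sets_eq
    by (rule approximable_sigma_sets[THEN conjunct2]) (use level in auto)
  show ?thesis
  proof (rule approximable_modify)
    fix \<epsilon> :: real assume "0 < \<epsilon>"
    moreover have "N' \<in> sets \<P>" "C.prob N' = 0"
      using S(3) null_setsD1[OF S(3)] null_setsD2[OF S(3)] by (auto simp: measure_def)
    ultimately show "\<exists>h. \<exists>B\<in>sets \<P>. approximable h \<and> C.prob B < \<epsilon> \<and>
       (\<forall>e\<in>boundary adj x0 - B. (e \<in> A) = h e)"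
      using \<open>approximable (\<lambda>e. e \<in> S)\<close> S
      by (intro exI[of _ "\<lambda>e. e \<in> S"] bexI[of _ N']) auto
  qed
qed

lemma approximable_nat:
  fixes g :: "'v set \<Rightarrow> nat"
  assumes "\<And>k. {e \<in> space \<P>. g e = k} \<in> sets \<P>"
  shows "approximable g"
proof (rule approximable_modify)
  define A where "A = (\<lambda>k. {e \<in> space \<P>. g e = k})"
  have A: "A k \<in> sets \<P>" for k using assms by (simp add: A_def)
  fix \<epsilon> :: real assume "0 < \<epsilon>"
  with A obtain K where K: "C.prob ((\<Union>k. A k) - (\<Union>k<K. A k)) < \<epsilon>"
    using prob_small_tail[of A \<epsilon>] by blast
  \<comment> \<open>Reads the value of \<open>g\<close> off the truth values of
    \<open>g e = k\<close> for \<open>k < K\<close>. If none is true, the guard \<open>k < K\<close>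
    yields the default \<open>K\<close>; inside the boundary this happens only on the exceptional
    set.\<close>
  define h where "h = (\<lambda>e. LEAST k. k < K \<longrightarrow> map (\<lambda>k. e \<in> A k) [0..<K] ! k)"
  have "approximable h"
    unfolding h_def by (rule approximable_compose[OF approximable_map[OF approximable_sets[OF A]]])
  moreover have "g e = h e" if "e \<in> boundary adj x0 - ((\<Union>k. A k) - (\<Union>k<K. A k))" for e
  proof -
    have "e \<in> A (g e)" "g e < K"
      using that by (auto simp: A_def space_eq)
    then show ?thesis
      unfolding h_def by (intro Least_equality[symmetric]) (auto simp: A_def)
  qed
  ultimately show "\<exists>h. \<exists>B\<in>sets \<P>. approximable h \<and> C.prob B < \<epsilon> \<and>
       (\<forall>e\<in>boundary adj x0 - B. g e = h e)"
    using K A by (intro exI[of _ h] bexI[of _ "(\<Union>k. A k) - (\<Union>k<K. A k)"]) auto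
qed

text \<open>Rounding to the first point of the dense sequence closer than \<open>\<delta>\<close>
  gives a measurable function with natural values, to which \<open>approximable_nat\<close>
  applies.\<close>

lemma approximate_measurable:
  fixes \<psi> :: "'v set \<Rightarrow> 'e::metric_space"
  assumes \<psi> [measurable]: "\<psi> \<in> borel_measurable \<P>" and "0 < \<epsilon>" "0 < \<delta>"
    and d: "\<And>a \<epsilon>. 0 < \<epsilon> \<Longrightarrow> \<exists>k. dist a (d k) < \<epsilon>"
  obtains L and v :: "'v \<Rightarrow> nat" and B where "ev_const L v" "B \<in> sets \<P>" "C.prob B < \<epsilon>"
    "\<forall>y m. ray y \<longrightarrow> range y \<notin> B \<longrightarrow> L \<le> m \<longrightarrow> dist (\<psi> (range y)) (d (v (y m))) < \<delta>"
proof -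
  have [measurable]: "(\<lambda>e. dist (\<psi> e) c) \<in> borel_measurable \<P>" for c
    by (auto intro!: measurable_compose[OF \<psi>] borel_measurable_continuous_onI continuous_intros)
  define g where "g = (\<lambda>e. LEAST k. dist (\<psi> e) (d k) < \<delta>)"
  have g: "dist (\<psi> e) (d (g e)) < \<delta>" for e
    unfolding g_def using d[OF \<open>0 < \<delta>\<close>] by (rule LeastI_ex)
  have "g e = k \<longleftrightarrow> dist (\<psi> e) (d k) < \<delta> \<and> (\<forall>i<k. \<not> dist (\<psi> e) (d i) < \<delta>)" for e k
    using g[of e] unfolding g_def
    by (metis (mono_tags, lifting) not_less_Least LeastI linorder_neqE_nat)
  then have "{e \<in> space \<P>. g e = k}
      = {e \<in> space \<P>. dist (\<psi> e) (d k) < \<delta> \<and> (\<forall>i\<in>{..<k}. \<not> dist (\<psi> e) (d i) < \<delta>)}" for k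
    by auto
  moreover have "\<dots> k \<in> sets \<P>" for k
    by measurable
  ultimately have "approximable g"
    by (intro approximable_nat) simp
  from this \<open>0 < \<epsilon>\<close> obtain L v B where "ev_const L v" "B \<in> sets \<P>" "C.prob B < \<epsilon>"
    "\<forall>y m. ray y \<longrightarrow> range y \<notin> B \<longrightarrow> L \<le> m \<longrightarrow> g (range y) = v (y m)"
    unfolding approximable_def by blast
  then show ?thesis
    by (intro that[of L v B]) (simp_all, metis g)
qed

text \<open>From level \<open>L\<close> on, such a function is determined by finitely many natural
  numbers, its values on level \<open>L\<close>. The enumeration obtained supplies the targets of
  steering.\<close>

lemma countable_ev_const:
  obtains \<phi> :: "nat \<Rightarrow> 'v \<Rightarrow> nat"
  where "\<And>L v. ev_const L v \<Longrightarrow> \<exists>i. \<forall>x. L \<le> lv x \<longrightarrow> \<phi> i x = v x"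
proof -
  \<comment> \<open>The free values at levels smaller than \<open>L\<close> are set to 0 to make
    restriction to level \<open>L\<close> injective.\<close>
  define F where "F = (\<lambda>L. {v :: 'v \<Rightarrow> nat. ev_const L v \<and> (\<forall>x. lv x < L \<longrightarrow> v x = 0)})"
  have "countable (F L)" for L
  proof (rule countable_image_inj_on)
    have "(\<lambda>v. restrict v (level adj x0 L)) ` F L \<subseteq> level adj x0 L \<rightarrow>\<^sub>E UNIV"
      by auto
    moreover have "countable (level adj x0 L \<rightarrow>\<^sub>E (UNIV :: nat set))"
      by (intro countable_PiE finite_level) simp
    ultimately show "countable ((\<lambda>v. restrict v (level adj x0 L)) ` F L)"
      by (rule countable_subset)
    show "inj_on (\<lambda>v. restrict v (level adj x0 L)) (F L)"
    proof (rule inj_onI)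
      fix v v' assume F: "v \<in> F L" "v' \<in> F L"
        and eq: "restrict v (level adj x0 L) = restrict v' (level adj x0 L)"
      have "lv x = L + k \<Longrightarrow> v x = v' x" for k x
      proof (induction k arbitrary: x)
        case 0
        then show ?case using fun_cong[OF eq, of x] by (simp add: level_def)
      next
        case (Suc k)
        then obtain p where "lv p = L + k" "x \<in> chd p" using ex_parent[of x "L + k"] by auto
        moreover from this have "v x = v p" "v' x = v' p"
          using F le_add1[of L k] unfolding F_def ev_const_def by auto
        ultimately show ?case using Suc(1)[of p] by simp
      qed
      then have "L \<le> lv x \<Longrightarrow> v x = v' x" for x
        by (metis le_add_diff_inverse)
      moreover have "lv x < L \<Longrightarrow> v x = v' x" for x
        using F by (simp add: F_def)
      ultimately show "v = v'"
        by (metis ext not_le)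
    qed
  qed
  then have count: "countable (\<Union>L. F L)" by simp
  show ?thesis
  proof (rule that)
    fix L and v :: "'v \<Rightarrow> nat" assume "ev_const L v"
    then have "(\<lambda>x. if lv x < L then 0 else v x) \<in> F L"
      by (auto simp: F_def ev_const_def lv_child)
    then have "(\<lambda>x. if lv x < L then 0 else v x) \<in> (\<Union>L. F L)" by blast
    then obtain i where "from_nat_into (\<Union>L. F L) i = (\<lambda>x. if lv x < L then 0 else v x)"
      using from_nat_into_surj[OF count] by blast
    then show "\<exists>i. \<forall>x. L \<le> lv x \<longrightarrow> from_nat_into (\<Union>L. F L) i x = v x"
      by (intro exI[of _ i]) auto
  qed
qed

end


section \<open>Steered harmonic functions\<close>

interpretation complex_vector: vector_space "scaleC :: complex \<Rightarrow> 'e \<Rightarrow> 'e::complex_normed_vector"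
  by unfold_locales (auto simp: scaleC_add_right scaleC_add_left scaleC_scaleC scaleC_one)

lemma dist_scaleC: "dist (c *\<^sub>C x) (c *\<^sub>C y) = cmod c * dist x y"
  by (simp add: dist_norm norm_scaleC flip: complex_vector.scale_right_diff_distrib)

lemma borel_measurable_scaleC:
  fixes f :: "'a \<Rightarrow> 'e::complex_normed_vector"
  assumes "f \<in> borel_measurable M"
  shows "(\<lambda>x. c *\<^sub>C f x) \<in> borel_measurable M"
proof -
  have "(cmod c)-lipschitz_on UNIV ((*\<^sub>C) c :: 'e \<Rightarrow> 'e)"
    by (rule lipschitz_onI) (simp_all add: dist_scaleC)
  then have "continuous_on UNIV ((*\<^sub>C) c :: 'e \<Rightarrow> 'e)"
    by (rule lipschitz_on_continuous_on)
  then show ?thesis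
    using assms by (intro measurable_compose[OF assms] borel_measurable_continuous_onI)
qed

lemma span_range_sequence:
  fixes F :: "nat \<Rightarrow> 'v \<Rightarrow> 'e::complex_normed_vector"
  assumes "g \<in> fun_space.span (range F)"
  obtains u J where "\<And>x. g x = (\<Sum>j<J. u j *\<^sub>C F j x)"
proof -
  have "\<exists>u J. \<forall>x. g x = (\<Sum>j<J. u j *\<^sub>C F j x)"
    using assms
  proof (induction rule: fun_space.span_induct_alt)
    case base
    show ?case by (intro exI[of _ "\<lambda>_. 0"] exI[of _ "0::nat"]) simp
  next
    case (step c f g)
    then obtain k u J where f: "f = F k" and g: "\<And>x. g x = (\<Sum>j<J. u j *\<^sub>C F j x)"
      by blast
    \<comment> \<open>Old coefficients are padded with 0; the sum of two terms treats
      \<open>k < J\<close> and \<open>k \<ge> J\<close> alike.\<close>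
    define u' where "u' = (\<lambda>j. (if j < J then u j else 0) + (if j = k then c else 0))"
    define J' where "J' = max J (Suc k)"
    have "(\<Sum>j<J'. u' j *\<^sub>C F j x) = (scaleC_fun c f + g) x" for x
    proof -
      have "(\<Sum>j<J'. u' j *\<^sub>C F j x) = (\<Sum>j<J'. if j < J then u j *\<^sub>C F j x else 0)
          + (\<Sum>j<J'. if j = k then c *\<^sub>C F j x else 0)"
        unfolding sum.distrib[symmetric] u'_def by (rule sum.cong) (auto simp: scaleC_add_left)
      also have "(\<Sum>j<J'. if j = k then c *\<^sub>C F j x else 0) = c *\<^sub>C F k x"
        by (simp add: J'_def less_max_iff_disj)
      also have "(\<Sum>j<J'. if j < J then u j *\<^sub>C F j x else 0) = (\<Sum>j<J. u j *\<^sub>C F j x)"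
        by (rule sum.mono_neutral_cong_right) (auto simp: J'_def)
      finally show ?thesis by (simp add: f g scaleC_fun_def)
    qed
    then show ?case by metis
  qed
  then show ?thesis using that by blast
qed

text \<open>Separability passes to \<open>H\<close>: for each code of finitely many coordinates and
  an accuracy, a member of \<open>H\<close> matching it is chosen if there is one. Each choice
  recurs with every value of \<open>\<nu> j\<close>, the level up to which \<open>h j\<close> will
  later be kept.\<close>

lemma dense_function_sequence:
  fixes H :: "('v \<Rightarrow> 'e::metric_space) set" and z :: "nat \<Rightarrow> 'v"
  assumes sep: "separable_space (euclidean :: 'e topology)" and "H \<noteq> {}"
  obtains h :: "nat \<Rightarrow> 'v \<Rightarrow> 'e" and \<nu> :: "nat \<Rightarrow> nat" where "\<And>j. h j \<in> H"
    "\<And>g N M \<epsilon>. g \<in> H \<Longrightarrow> 0 < \<epsilon> \<Longrightarrow> \<exists>j. M \<le> \<nu> j \<and> (\<forall>n<N. dist (h j (z n)) (g (z n)) < \<epsilon>)"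
proof -
  obtain d :: "nat \<Rightarrow> 'e" where d: "\<And>a \<epsilon>. 0 < \<epsilon> \<Longrightarrow> \<exists>k. dist a (d k) < \<epsilon>"
    using separable_dense_sequence[OF sep] by blast
  \<comment> \<open>\<open>c\<close> lists indices of points near the first values and
    \<open>k\<close> fixes the accuracy; \<open>l\<close> leaves the set unchanged and reappears as
    \<open>\<nu>\<close>.\<close>
  define A where "A = (\<lambda>(c, k, l :: nat).
    {f \<in> H. \<forall>n<length c. dist (f (z n)) (d (c ! n)) < inverse (real (Suc k))})"
  define h where "h = (\<lambda>j. SOME f. f \<in> H \<and> (A (from_nat j) \<noteq> {} \<longrightarrow> f \<in> A (from_nat j)))"
  define \<nu> where "\<nu> = (\<lambda>j. case from_nat j :: nat list \<times> nat \<times> nat of (c, k, l) \<Rightarrow> l)"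
  have h: "h j \<in> H \<and> (A (from_nat j) \<noteq> {} \<longrightarrow> h j \<in> A (from_nat j))" for j
  proof -
    have "\<exists>f. f \<in> H \<and> (A (from_nat j) \<noteq> {} \<longrightarrow> f \<in> A (from_nat j))"
    proof (cases "A (from_nat j) = {}")
      case False
      moreover have "A (from_nat j) \<subseteq> H" by (auto simp: A_def split: prod.splits)
      ultimately show ?thesis by blast
    qed (use \<open>H \<noteq> {}\<close> in auto)
    then show ?thesis unfolding h_def by (rule someI_ex)
  qed
  show ?thesis
  proof (rule that)
    show "h j \<in> H" for j using h by blast
    fix g and N M :: nat and \<epsilon> :: real assume "g \<in> H" "0 < \<epsilon>"
    then obtain k where k: "inverse (real (Suc k)) < \<epsilon> / 2"
      using reals_Archimedean[of "\<epsilon> / 2"] by auto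
    have "\<forall>n. \<exists>i. dist (g (z n)) (d i) < inverse (real (Suc k))"
      by (intro allI d) simp
    then obtain i where i: "\<And>n. dist (g (z n)) (d (i n)) < inverse (real (Suc k))"
      by metis
    define j where "j = to_nat (map i [0..<N], k, M)"
    have j: "from_nat j = (map i [0..<N], k, M)" by (simp add: j_def)
    have "g \<in> A (from_nat j)"
      using \<open>g \<in> H\<close> i by (simp add: j A_def)
    then have "h j \<in> A (from_nat j)" using h by blast
    then have hj: "dist (h j (z n)) (d (i n)) < inverse (real (Suc k))" if "n < N" for n
      using that by (simp add: j A_def)
    have "dist (h j (z n)) (g (z n)) < \<epsilon>" if "n < N" for n
      using dist_triangle2[of "h j (z n)" "g (z n)" "d (i n)"] hj[OF that] i[of n] k by linarith
    then show "\<exists>j. M \<le> \<nu> j \<and> (\<forall>n<N. dist (h j (z n)) (g (z n)) < \<epsilon>)"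
      by (intro exI[of _ j]) (simp add: \<nu>_def j)
  qed
qed

context boundary_tree
begin

section \<open>Steering a single harmonic function\<close>

lemma subspace_harmonic: "fun_space.subspace (harmonic_functions adj x0 w :: ('v \<Rightarrow> 'e::complex_normed_vector) set)"
  unfolding fun_space.subspace_def
proof (intro conjI ballI allI)
  show "(0 :: 'v \<Rightarrow> 'e) \<in> harmonic_functions adj x0 w"
    by (simp add: harmonic_functions_def)
next
  fix f g :: "'v \<Rightarrow> 'e"
  assume "f \<in> harmonic_functions adj x0 w" "g \<in> harmonic_functions adj x0 w"
  then have f: "f x = (\<Sum>y\<in>chd x. w x y *\<^sub>C f y)" and g: "g x = (\<Sum>y\<in>chd x. w x y *\<^sub>C g y)" for x
    unfolding harmonic_functions_def by blast+
  have "(f + g) x = (\<Sum>y\<in>chd x. w x y *\<^sub>C (f + g) y)" for x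
    unfolding plus_fun_apply scaleC_add_right sum.distrib f[of x, symmetric] g[of x, symmetric] ..
  then show "f + g \<in> harmonic_functions adj x0 w"
    unfolding harmonic_functions_def by blast
next
  fix c and f :: "'v \<Rightarrow> 'e"
  assume "f \<in> harmonic_functions adj x0 w"
  then have f: "f x = (\<Sum>y\<in>chd x. w x y *\<^sub>C f y)" for x
    unfolding harmonic_functions_def by blast
  have "c *\<^sub>C f x = (\<Sum>y\<in>chd x. w x y *\<^sub>C c *\<^sub>C f y)" for x
    by (subst f) (simp add: complex_vector.scale_sum_right mult.commute)
  then show "scaleC_fun c f \<in> harmonic_functions adj x0 w"
    unfolding harmonic_functions_def scaleC_fun_def by blast
qed

text \<open>
  Since \<open>\<Sum>w = 1\<close>, the value at the light child forced by the equation at its parent differs from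
  the target by the deviation at the parent divided by the weight. In particular no deviation arises
  below a vertex at which the target is attained.
\<close>

primrec steer :: "('v \<Rightarrow> 'e::complex_normed_vector) \<Rightarrow> nat \<Rightarrow> (nat \<Rightarrow> 'v \<Rightarrow> 'e) \<Rightarrow> nat \<Rightarrow> 'v \<Rightarrow> 'e" where
  "steer h \<nu> \<tau> 0 x = h x"
| "steer h \<nu> \<tau> (Suc n) x =
    (if n < \<nu> then h x
     else \<tau> n (parent x) +
       (if x = light (parent x)
        then inverse (w (parent x) x) *\<^sub>C (steer h \<nu> \<tau> n (parent x) - \<tau> n (parent x)) else 0))"

definition steered :: "('v \<Rightarrow> 'e::complex_normed_vector) \<Rightarrow> nat \<Rightarrow> (nat \<Rightarrow> 'v \<Rightarrow> 'e) \<Rightarrow> 'v \<Rightarrow> 'e" where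
  "steered h \<nu> \<tau> x = steer h \<nu> \<tau> (lv x) x"

text \<open>Level \<open>\<nu>\<close> itself still carries \<open>h\<close>; the first steered
  level is \<open>Suc \<nu>\<close>.\<close>

lemma steered_initial: "lv x \<le> \<nu> \<Longrightarrow> steered h \<nu> \<tau> x = h x"
  by (cases "lv x") (auto simp: steered_def)

text \<open>The target is read at the parent \<open>x\<close>, so all children receive the same
  value, apart from the correction at the light one.\<close>

lemma steered_child:
  assumes "\<nu> \<le> lv x" "y \<in> chd x"
  shows "steered h \<nu> \<tau> y = \<tau> (lv x) x +
    (if y = light x then inverse (w x y) *\<^sub>C (steered h \<nu> \<tau> x - \<tau> (lv x) x) else 0)"
  using assms by (simp add: steered_def lv_child parent_eq parent_eq[OF light(1)])

lemma steered_harmonic: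
  assumes "h \<in> harmonic_functions adj x0 w"
  shows "steered h \<nu> \<tau> \<in> harmonic_functions adj x0 w"
proof -
  have "steered h \<nu> \<tau> x = (\<Sum>y\<in>chd x. w x y *\<^sub>C steered h \<nu> \<tau> y)" for x
  proof (cases "lv x < \<nu>")
    case True
    have "steered h \<nu> \<tau> x = h x"
      using True by (simp add: steered_initial)
    also have "\<dots> = (\<Sum>y\<in>chd x. w x y *\<^sub>C h y)"
      using assms unfolding harmonic_functions_def by blast
    also have "\<dots> = (\<Sum>y\<in>chd x. w x y *\<^sub>C steered h \<nu> \<tau> y)"
      using True by (intro sum.cong) (auto simp: steered_initial lv_child)
    finally show ?thesis .
  next
    case False
    define t where "t = \<tau> (lv x) x"
    have "(\<Sum>y\<in>chd x. w x y *\<^sub>C steered h \<nu> \<tau> y)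
        = (\<Sum>y\<in>chd x. w x y *\<^sub>C t + (if y = light x then steered h \<nu> \<tau> x - t else 0))"
      using False
      by (intro sum.cong) (auto simp: steered_child[of \<nu> x _ h \<tau>] t_def scaleC_add_right scaleC_scaleC scaleC_one w_nonzero)
    also have "\<dots> = (\<Sum>y\<in>chd x. w x y) *\<^sub>C t + (steered h \<nu> \<tau> x - t)"
      by (simp add: sum.distrib finite_children light complex_vector.scale_sum_left)
    finally show ?thesis by (simp add: w_sum scaleC_one)
  qed
  then show ?thesis unfolding harmonic_functions_def by blast
qed

text \<open>Leaving the light child once removes the deviation, and afterwards even light children
  receive the target. Targets at levels before \<open>b\<close> determine the values up to and
  including level \<open>b\<close>.\<close>

lemma steered_ray:
  assumes y: "ray y" and "\<nu> \<le> a" and t: "\<And>n. a \<le> n \<Longrightarrow> n < b \<Longrightarrow> \<tau> n (y n) = t"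
    and off: "a \<le> i" "y (Suc i) \<noteq> light (y i)" and "Suc i \<le> m" "m \<le> b"
  shows "steered h \<nu> \<tau> (y m) = t"
  using \<open>Suc i \<le> m\<close> \<open>m \<le> b\<close>
proof (induction m rule: dec_induct)
  case base
  then show ?case
    using assms steered_child[of \<nu> "y i" "y (Suc i)" h \<tau>] by (simp add: ray_lv ray_child)
next
  case (step m)
  then show ?case
    using assms steered_child[of \<nu> "y m" "y (Suc m)" h \<tau>] by (simp add: ray_lv ray_child)
qed

lemma boundary_value_measurable: "boundary_value adj x0 n f \<in> borel_measurable \<P>"
  for f :: "'v \<Rightarrow> 'e::topological_space"
proof (rule measurable_completion, rule measurableI)
  fix U :: "'e set" assume "U \<in> sets borel"
  have "boundary_value adj x0 n f -` U \<inter> space \<mu> = (\<Union>x\<in>level adj x0 n \<inter> f -` U. cyl adj x0 x)"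
  proof (intro set_eqI iffI)
    fix e assume "e \<in> boundary_value adj x0 n f -` U \<inter> space \<mu>"
    then obtain y where "ray y" "e = range y" "f (y n) \<in> U"
      by (auto simp: space_eq boundary_value_ray elim!: boundaryE)
    then show "e \<in> (\<Union>x\<in>level adj x0 n \<inter> f -` U. cyl adj x0 x)"
      by (intro UN_I[of "y n"]) (auto simp: level_def ray_lv ray_cyl)
  next
    fix e assume "e \<in> (\<Union>x\<in>level adj x0 n \<inter> f -` U. cyl adj x0 x)"
    then obtain x where x: "lv x = n" "f x \<in> U" "e \<in> cyl adj x0 x"
      by (auto simp: level_def)
    then obtain y where "ray y" "e = range y"
      by (auto simp: cyl_def elim: boundaryE)
    with x show "e \<in> boundary_value adj x0 n f -` U \<inter> space \<mu>"
      by (simp add: space_eq boundary_value_ray range_in_boundary ray_cyl)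
  qed
  also have "\<dots> \<in> sets \<mu>"
    by (intro sets.finite_UN finite_Int) (auto simp: finite_level)
  finally show "boundary_value adj x0 n f -` U \<inter> space \<mu> \<in> sets \<mu>" .
qed simp

end


section \<open>Universality\<close>

text \<open>Recovers the stage from a level in it. Factorials are used because each stage ends
  \<open>Suc s\<close> times as far as it starts, a ratio that tends to infinity.\<close>

lemma stage_eq:
  fixes n :: nat
  assumes "fact s \<le> n" "n < fact (Suc s)"
  shows "(LEAST s. n < fact (Suc s)) = s"
proof (rule Least_equality)
  fix s' assume "n < fact (Suc s')"
  show "s \<le> s'"
  proof (rule ccontr)
    assume "\<not> s \<le> s'"
    then have "fact (Suc s') \<le> (fact s :: nat)" by (intro fact_mono) simp
    with assms \<open>n < fact (Suc s')\<close> show False by linarith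
  qed
qed (rule assms)

context boundary_tree
begin

text \<open>
  Stage \<open>s\<close> consists of the levels from \<open>fact s\<close> up to \<open>fact (Suc s)\<close>. It codes a pair \<open>(r, i)\<close>, every
  pair being coded by infinitely many stages: the \<open>r\<close>-th function is steered towards the \<open>i\<close>-th
  target and all others towards 0, so that a combination with nonzero \<open>r\<close>-th coefficient inherits
  the density of the targets.
\<close>

lemma universal_span:
  fixes h :: "nat \<Rightarrow> 'v \<Rightarrow> 'e::complex_normed_vector" and \<phi> :: "nat \<Rightarrow> 'v \<Rightarrow> nat"
  assumes sep: "separable_space (euclidean :: 'e topology)"
    and d: "\<And>a \<epsilon>. 0 < \<epsilon> \<Longrightarrow> \<exists>k. dist a (d k) < \<epsilon>"
    and \<phi>: "\<And>L v. ev_const L v \<Longrightarrow> \<exists>i. \<forall>x. L \<le> lv x \<longrightarrow> \<phi> i x = v x"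
    and h: "\<And>j. h j \<in> harmonic_functions adj x0 w"
    and \<tau>: "\<tau> = (\<lambda>j (n :: nat) x. case prod_decode (fst (prod_decode (LEAST s. n < fact (Suc s)))) of
      (r, i) \<Rightarrow> if j = r then d (\<phi> i x) else 0)"
    and F: "F = (\<lambda>j. steered (h j) (\<nu> j) (\<tau> j))"
    and g: "g \<in> fun_space.span (range F)" "g \<noteq> 0"
  shows "g \<in> universal_harmonic adj x0 w \<P>"
  unfolding universal_harmonic_def
proof (intro CollectI conjI allI impI)
  have "range F \<subseteq> harmonic_functions adj x0 w"
    using h by (auto simp: F intro: steered_harmonic)
  then have "fun_space.span (range F) \<subseteq> harmonic_functions adj x0 w"
    by (rule fun_space.span_minimal[OF _ subspace_harmonic])
  then show "g \<in> harmonic_functions adj x0 w" using g by blast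
  obtain u J where uJ: "\<And>x. g x = (\<Sum>j<J. u j *\<^sub>C F j x)"
    using span_range_sequence[OF g(1)] by blast
  obtain r where r: "r < J" "u r \<noteq> 0"
  proof (rule ccontr)
    assume "\<not> thesis"
    then have "u j = 0" if "j < J" for j using that \<open>\<And>r. r < J \<Longrightarrow> u r \<noteq> 0 \<Longrightarrow> thesis\<close> by blast
    then have "g = 0" by (simp add: fun_eq_iff uJ)
    with g(2) show False by simp
  qed
  interpret L: Metric_space "L0 \<P> :: ('v set \<Rightarrow> 'e) set set" "L0_dist \<P>"
    by (rule Metric_space_L0[OF C.prob_space_axioms sep])
  fix V :: "('v set \<Rightarrow> 'e) set set"
  assume "openin (L0_topology \<P>) V \<and> V \<noteq> {}"
  then have V: "openin L.mtopology V" "V \<noteq> {}" by (simp_all add: L0_topology_def)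
  then obtain A \<epsilon>0 where A: "A \<in> V" "A \<in> L0 \<P>" "0 < \<epsilon>0" "L.mball A \<epsilon>0 \<subseteq> V"
    unfolding L.openin_mtopology by blast
  then obtain \<psi> where \<psi>: "A = ae_rel \<P> `` {\<psi>}" "\<psi> \<in> borel_measurable \<P>"
    unfolding L0_def by (auto elim!: quotientE)
  \<comment> \<open>Half of \<open>\<epsilon>0\<close> is shared by the scaled approximation error,
    \<open>cmod (u r) * \<delta>\<close>, and the measure of \<open>B\<close>, below
    \<open>\<delta>\<close>. The other half is for the rays that keep to light children.\<close>
  define \<kappa> where "\<kappa> = cmod (u r) + 1"
  have "0 < \<kappa>" unfolding \<kappa>_def by (rule add_nonneg_pos) auto
  define \<delta> where "\<delta> = \<epsilon>0 / 2 / \<kappa>"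
  have "0 < \<delta>" "\<kappa> * \<delta> = \<epsilon>0 / 2"
    using A(3) \<open>0 < \<kappa>\<close> by (simp_all add: \<delta>_def)
  then have \<delta>: "0 < \<delta>" "(cmod (u r) + 1) * \<delta> = \<epsilon>0 / 2"
    by (simp_all only: \<kappa>_def)
  \<comment> \<open>In a stage for \<open>r\<close> the combination attains \<open>u r\<close> times
    the target, so the target has to approximate \<open>\<psi>\<close> divided by
    \<open>u r\<close>.\<close>
  define \<psi>' where "\<psi>' = (\<lambda>e. inverse (u r) *\<^sub>C \<psi> e)"
  have "\<psi>' \<in> borel_measurable \<P>"
    unfolding \<psi>'_def by (rule borel_measurable_scaleC[OF \<psi>(2)])
  then obtain L v B where ev: "ev_const L v" and B: "B \<in> sets \<P>" "C.prob B < \<delta>"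
    and v: "\<forall>y m. ray y \<longrightarrow> range y \<notin> B \<longrightarrow> L \<le> m \<longrightarrow> dist (\<psi>' (range y)) (d (v (y m))) < \<delta>"
    using approximate_measurable[OF _ \<delta>(1) \<delta>(1) d] by blast
  obtain i where i: "\<And>x. L \<le> lv x \<Longrightarrow> \<phi> i x = v x"
    using \<phi>[OF ev] by blast
  obtain K where K: "(1/2) ^ K < \<epsilon>0 / 2"
    using real_arch_pow_inv[of "\<epsilon>0 / 2" "1/2"] A(3) by auto

  \<comment> \<open>Once \<open>K\<close> steps of a suitable stage have passed, every level up to
    its end is good. The conditions on \<open>s\<close> let the stage start where \<open>v\<close>
    is constant along rays and all functions involved are being steered.\<close>
  have hit: "ae_rel \<P> `` {boundary_value adj x0 m g} \<in> V"
    if s: "s = prod_encode (prod_encode (r, i), S)" "L \<le> fact s" "\<And>j. j < J \<Longrightarrow> \<nu> j \<le> fact s"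
      and m: "fact s + K \<le> m" "m \<le> fact (Suc s)" for S s m
  proof -
    obtain B' where B': "B' \<in> sets \<mu>" "prob B' \<le> (1/2) ^ K"
      "\<And>y. ray y \<Longrightarrow> \<forall>i<K. y (Suc (fact s + i)) = light (y (fact s + i)) \<Longrightarrow> range y \<in> B'"
      using light_rays[of K "fact s"] by blast
    have "dist (\<psi> e) (boundary_value adj x0 m g e) \<le> cmod (u r) * \<delta>"
      if e: "e \<in> space \<P>" "e \<notin> B \<union> B'" for e
    proof -
      obtain y where y: "ray y" "e = range y"
        using e by (auto simp: space_eq elim: boundaryE)
      then obtain k where k: "k < K" "y (Suc (fact s + k)) \<noteq> light (y (fact s + k))"
        using B'(3) e by blast
      have "F j (y m) = (if j = r then d (v (y L)) else 0)" if "j < J" for j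
        unfolding F
      proof (rule steered_ray[OF y(1) s(3)[OF that] _ _ k(2)])
        fix n :: nat assume n: "fact s \<le> n" "n < fact (Suc s)"
        have "\<phi> i (y n) = v (y L)"
          using i[of "y n"] n s(2) ev_const_ray[OF ev y(1), of n] ray_lv[OF y(1), of n] by simp
        then show "\<tau> j n (y n) = (if j = r then d (v (y L)) else 0)"
          unfolding \<tau> stage_eq[OF n] s(1) by simp
      qed (use k m in auto)
      then have "g (y m) = (\<Sum>j<J. if j = r then u j *\<^sub>C d (v (y L)) else 0)"
        unfolding uJ by (intro sum.cong) auto
      then have "g (y m) = u r *\<^sub>C d (v (y L))"
        using r by simp
      moreover have "\<psi> e = u r *\<^sub>C \<psi>' e"
        using r(2) by (simp add: \<psi>'_def scaleC_scaleC scaleC_one)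
      ultimately have "dist (\<psi> e) (boundary_value adj x0 m g e) = cmod (u r) * dist (\<psi>' e) (d (v (y L)))"
        using y by (simp add: boundary_value_ray dist_scaleC)
      also have "\<dots> \<le> cmod (u r) * \<delta>"
        using v e y by (intro mult_left_mono) (auto intro: less_imp_le)
      finally show ?thesis .
    qed
    then have "L0_dist \<P> A (ae_rel \<P> `` {boundary_value adj x0 m g}) \<le> cmod (u r) * \<delta> + C.prob (B \<union> B')"
      unfolding \<psi>(1) using \<delta>(1) B(1) B'(1)
      by (intro L0_dist_le[OF C.prob_space_axioms sep \<psi>(2) boundary_value_measurable]) auto
    also have "C.prob (B \<union> B') \<le> C.prob B + (1/2) ^ K"
      using measure_Un_le[OF B(1), of B'] B' by simp
    also have "cmod (u r) * \<delta> + (C.prob B + (1/2) ^ K) < \<epsilon>0"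
      using B(2) \<delta>(2) K by (simp add: distrib_right)
    finally have "ae_rel \<P> `` {boundary_value adj x0 m g} \<in> L.mball A \<epsilon>0"
      using A(2) L0_class[OF C.prob_space_axioms sep boundary_value_measurable] by auto
    then show ?thesis using A(4) by blast
  qed

  show "upper_density {n. 1 \<le> n \<and> ae_rel \<P> `` {boundary_value adj x0 n g} \<in> V} = 1"
  proof (rule upper_density_eq_1)
    fix \<epsilon> :: real and N0 :: nat assume "0 < \<epsilon>"
    define G where "G = {n. 1 \<le> n \<and> ae_rel \<P> `` {boundary_value adj x0 n g} \<in> V}"
    \<comment> \<open>Makes the possibly bad initial part \<open>a + K \<le> (1 + K) * a\<close> at
      most \<open>\<epsilon> * Suc s * a\<close>, which is \<open>\<epsilon> * N\<close>.\<close>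
    obtain S0 :: nat where S0: "(1 + real K) / \<epsilon> < real S0"
      using reals_Archimedean2 by blast
    \<comment> \<open>The second component of the stage code is free; taking it large forces a late
      stage, since \<open>S \<le> s \<le> fact s\<close>.\<close>
    define S where "S = S0 + N0 + L + (\<Sum>j<J. \<nu> j)"
    define s where "s = prod_encode (prod_encode (r, i), S)"
    have "S \<le> s" unfolding s_def by (rule le_prod_encode_2)
    then have fs: "S \<le> fact s" using fact_ge_self[of s] by linarith
    define a where "a = (fact s :: nat)"
    define N where "N = (fact (Suc s) :: nat)"
    have N: "N = Suc s * a" by (simp add: N_def a_def)
    have a: "1 \<le> a" by (simp add: a_def)
    have \<nu>: "\<nu> j \<le> fact s" if "j < J" for j
      using member_le_sum[of j "{..<J}" \<nu>] that fs by (simp add: S_def)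
    have "{a + K..N} \<subseteq> G \<inter> {1..N}"
    proof
      fix m assume m: "m \<in> {a + K..N}"
      have "L \<le> fact s" using fs by (simp add: S_def)
      with m have "ae_rel \<P> `` {boundary_value adj x0 m g} \<in> V"
        by (intro hit[OF s_def _ \<nu>]) (simp_all add: a_def N_def)
      with m a show "m \<in> G \<inter> {1..N}" by (simp add: G_def)
    qed
    then have "card {a + K..N} \<le> card (G \<inter> {1..N})"
      by (intro card_mono) auto
    then have card: "real N - real (a + K) \<le> real (card (G \<inter> {1..N}))"
      by simp
    have "1 + real K \<le> \<epsilon> * real (Suc s)"
    proof -
      have "1 + real K \<le> \<epsilon> * real S0" using S0 \<open>0 < \<epsilon>\<close> by (simp add: field_simps)
      also have "\<dots> \<le> \<epsilon> * real (Suc s)"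
        using \<open>0 < \<epsilon>\<close> \<open>S \<le> s\<close> by (intro mult_left_mono) (auto simp: S_def)
      finally show ?thesis .
    qed
    have "real (a + K) \<le> (1 + real K) * real a"
      using mult_left_mono[of 1 "real a" "real K"] a by (simp add: algebra_simps)
    also have "\<dots> \<le> \<epsilon> * real (Suc s) * real a"
      using \<open>1 + real K \<le> \<epsilon> * real (Suc s)\<close> by (intro mult_right_mono) auto
    also have "\<dots> = \<epsilon> * real N" by (simp add: N algebra_simps)
    finally have "(1 - \<epsilon>) * real N \<le> real (card (G \<inter> {1..N}))"
      using card by (simp add: algebra_simps)
    moreover have "0 < N" by (simp add: N_def)
    ultimately have "1 - \<epsilon> \<le> real (card (G \<inter> {1..N})) / real N"
      by (simp add: le_divide_eq)
    moreover have "N0 \<le> N"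
      using fs fact_mono_nat[of s "Suc s"] by (simp add: S_def N_def)
    ultimately show "\<exists>N\<ge>N0. 1 - \<epsilon> \<le> real (card ({n. 1 \<le> n \<and> ae_rel \<P> `` {boundary_value adj x0 n g} \<in> V} \<inter> {1..N})) / real N"
      unfolding G_def by blast
  qed
qed

end

theorem theorem3p4:
  fixes adj :: "'v \<Rightarrow> 'v \<Rightarrow> bool" and x0 :: 'v
    and q :: "'v \<Rightarrow> 'v \<Rightarrow> real" and w :: "'v \<Rightarrow> 'v \<Rightarrow> complex"
    and \<mu> :: "'v set measure" and z :: "nat \<Rightarrow> 'v"
  assumes "separable_space (euclidean :: 'e::complex_normed_vector topology)"
    and "tree_graph adj"
    and "\<And>n. finite (level adj x0 n)"
    and "\<And>x. \<exists>a\<in>children adj x0 x. \<exists>b\<in>children adj x0 x. a \<noteq> b"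
    and "\<And>x y. y \<in> children adj x0 x \<Longrightarrow> q x y > 0"
    and "\<And>x. (\<Sum>y\<in>children adj x0 x. q x y) = 1"
    and "\<And>x y. y \<in> children adj x0 x \<Longrightarrow> w x y \<noteq> 0"
    and "\<And>x. (\<Sum>y\<in>children adj x0 x. w x y) = 1"
    and "boundary_measure adj x0 q \<mu>"
    and "bij z"
  shows "\<exists>W :: ('v \<Rightarrow> 'e) set.
           fun_space.subspace W \<and>
           W \<subseteq> universal_harmonic adj x0 w (completion \<mu>) \<union> {0} \<and>
           harmonic_topology adj x0 w z closure_of W = harmonic_functions adj x0 w"
proof -
  interpret boundary_tree adj x0 q w \<mu>
    using assms(2-9) by unfold_locales
  let ?H = "harmonic_functions adj x0 w :: ('v \<Rightarrow> 'e) set"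
  have "?H \<noteq> {}"
    using fun_space.subspace_0[OF subspace_harmonic] by blast
  then obtain h :: "nat \<Rightarrow> 'v \<Rightarrow> 'e" and \<nu> :: "nat \<Rightarrow> nat" where h: "\<And>j. h j \<in> ?H"
    and dense: "\<And>g N M \<epsilon>. g \<in> ?H \<Longrightarrow> 0 < \<epsilon> \<Longrightarrow> \<exists>j. M \<le> \<nu> j \<and> (\<forall>n<N. dist (h j (z n)) (g (z n)) < \<epsilon>)"
    using dense_function_sequence[OF assms(1), of ?H z] by blast
  obtain d :: "nat \<Rightarrow> 'e" where d: "\<And>a \<epsilon>. 0 < \<epsilon> \<Longrightarrow> \<exists>k. dist a (d k) < \<epsilon>"
    using separable_dense_sequence[OF assms(1)] by blast
  obtain \<phi> :: "nat \<Rightarrow> 'v \<Rightarrow> nat" where \<phi>: "\<And>L v. ev_const L v \<Longrightarrow> \<exists>i. \<forall>x. L \<le> lv x \<longrightarrow> \<phi> i x = v x"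
    using countable_ev_const by blast
  define \<tau> where "\<tau> = (\<lambda>j (n :: nat) x. case prod_decode (fst (prod_decode (LEAST s. n < fact (Suc s)))) of
      (r, i) \<Rightarrow> if j = r then d (\<phi> i x) else 0)"
  define F where "F = (\<lambda>j. steered (h j) (\<nu> j) (\<tau> j))"
  let ?W = "fun_space.span (range F)"
  have universal: "?W \<subseteq> universal_harmonic adj x0 w \<P> \<union> {0}"
    using universal_span[OF assms(1) d \<phi> h \<tau>_def F_def] by blast
  then have W_H: "?W \<subseteq> ?H"
    using fun_space.subspace_0[OF subspace_harmonic] by (auto simp: universal_harmonic_def)
  interpret Metric_space UNIV "pointwise_dist z :: ('v \<Rightarrow> 'e) \<Rightarrow> _"
    by (rule Metric_space_pointwise_dist[OF assms(10)])
  have "g \<in> mtopology closure_of ?W" if gH: "g \<in> ?H" for g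
    unfolding metric_closure_of
  proof (intro CollectI conjI allI impI UNIV_I)
    fix \<epsilon> :: real assume "0 < \<epsilon>"
    then obtain N where N: "(1/2) ^ N < \<epsilon> / 2"
      using real_arch_pow_inv[of "\<epsilon> / 2" "1/2"] by auto
    \<comment> \<open>The sum bounds the level of each of the first \<open>N\<close> vertices, so
      steering starts after all of them and \<open>F j\<close> equals \<open>h j\<close>
      there.\<close>
    obtain j where j: "(\<Sum>n<N. lv (z n)) \<le> \<nu> j" "\<And>n. n < N \<Longrightarrow> dist (h j (z n)) (g (z n)) < \<epsilon> / 2"
      using dense[OF gH, of "\<epsilon> / 2" "\<Sum>n<N. lv (z n)" N] \<open>0 < \<epsilon>\<close> by auto
    have "dist (g (z n)) (F j (z n)) \<le> \<epsilon> / 2" if "n < N" for n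
    proof -
      have "lv (z n) \<le> \<nu> j"
        using member_le_sum[of n "{..<N}" "\<lambda>n. lv (z n)"] that j(1) by simp
      then show ?thesis
        using j(2)[OF that] by (simp add: F_def steered_initial dist_commute less_imp_le)
    qed
    then have "pointwise_dist z g (F j) \<le> \<epsilon> / 2 + (1/2) ^ N"
      using \<open>0 < \<epsilon>\<close> by (intro pointwise_dist_le) auto
    with N have "F j \<in> mball g \<epsilon>" by simp
    then show "\<exists>f\<in>?W. f \<in> mball g \<epsilon>"
      by (intro bexI[of _ "F j"] fun_space.span_base) auto
  qed
  then have "harmonic_topology adj x0 w z closure_of ?W = ?H"
    using W_H by (auto simp: harmonic_topology_def closure_of_subtopology Int_absorb1)
  then show ?thesis
    using universal by (intro exI[of _ ?W] conjI fun_space.subspace_span)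
qed

end
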